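(* Let $(\mathcal{M},g)$ be a complete Riemannian manifold with $R:=\inf_{x\in\mathcal{M}}r(x)>0$, where $r(x)$ is the injectivity radius at $x$. Let $\mathcal{H}_N=(\mathcal{V},\mathcal{E})$ be the cycle graph with $\mathcal{V}=\{1,\ldots,N\}$ and $\mathcal{E}=\{\{i,i+1\}\mid i\in\mathcal{V}\}$ (indices modulo $N$), with weights $w_{i,i+1}=w_{i+1,i}\in(0,\infty)$. Then every splay state $x=(x_i)_{i=1}^N\in\mathcal{M}^N$ is an equilibrium of the geodesic consensus system over $\mathcal{H}_N$, $$\dot{x}_i=w_{i-1,i}\log_{x_i}(x_{i-1})+w_{i,i+1}\log_{x_i}(x_{i+1}),\quad i\in\mathcal{V}.$$
   Context: $\mathcal{M}$ is a real smooth connected manifold and $d_g$ denotes the geodesic distance, i.e. the infimum of the lengths of piecewise smooth curves joining two points. The length of a curve $\gamma:[a,b]\to\mathcal{M}$ is $l(\gamma)=\int_a^b g_\gamma(\dot\gamma,\dot\gamma)^{1/2}\,\mathrm{d}t$. A geodesic from $x$ to $y$ means a curve of minimal length from $x$ to $y$; completeness guarantees existence. The injectivity radius $r(x)$ is the radius of the largest geodesic ball around $x$ on which the inverse $\log_x$ of the exponential map $\exp_x$ is a well-defined diffeomorphism. Indices are taken modulo $N$ ($N+1\equiv 1$), and $N\ge 3$. Concatenation of curves (with matching endpoints and parametrizations) is denoted $\ast$. Splay state: a configuration $x=(x_i)_{i=1}^N\in\mathcal{M}^N$ such that for each $i\in\mathcal{V}$ there is a unique geodesic $\gamma_i$ from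 $x_i$ to $x_{i+1}$, the concatenation $\gamma:=\gamma_1\ast\cdots\ast\gamma_N$ is a closed geodesic (a closed curve that is geodesic at every point, including the points $x_i$), and for some $\varepsilon>0$, $$d_g(x_i,x_{i+1})=l(\gamma_i)=\frac{w_{i,i+1}^{-1}}{\sum_{j=1}^N w_{j,j+1}^{-1}}\,l(\gamma)<R-\varepsilon\quad\text{for all } i\in\mathcal{V}.$$ *)

theory Defs
  imports "HOL-Analysis.Analysis"
begin

section \<open>Smooth maps between Euclidean spaces\<close>

text \<open>Used for open \<open>S\<close> only.\<close>

primrec Ck_on :: "nat \<Rightarrow> ('a::euclidean_space \<Rightarrow> 'b::euclidean_space) \<Rightarrow> 'a set \<Rightarrow> bool" where
  "Ck_on 0 f S \<longleftrightarrow> continuous_on S f"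
| "Ck_on (Suc k) f S \<longleftrightarrow>
     (\<forall>x\<in>S. f differentiable (at x)) \<and> (\<forall>v. Ck_on k (\<lambda>x. frechet_derivative f (at x) v) S)"

definition smooth_on :: "('a::euclidean_space \<Rightarrow> 'b::euclidean_space) \<Rightarrow> 'a set \<Rightarrow> bool" where
  "smooth_on f S \<longleftrightarrow> (\<forall>k. Ck_on k f S)"


section \<open>Smooth manifolds\<close>

text \<open>The manifold is the whole type \<open>'a\<close>; Hausdorffness and second countability are sort
  constraints of the main result. A chart is a pair of its domain and its coordinate map, the
  latter being meaningful on the domain only. An atlas need not be maximal.\<close>

type_synonym ('a, 'e) chart = "'a set \<times> ('a \<Rightarrow> 'e)"

definition chart_inv :: "('a, 'e) chart \<Rightarrow> 'e \<Rightarrow> 'a" where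
  "chart_inv \<phi> = inv_into (fst \<phi>) (snd \<phi>)"

definition is_chart :: "('a::topological_space, 'e::euclidean_space) chart \<Rightarrow> bool" where
  "is_chart \<phi> \<longleftrightarrow> open (fst \<phi>) \<and> open (snd \<phi> ` fst \<phi>) \<and>
     homeomorphism (fst \<phi>) (snd \<phi> ` fst \<phi>) (snd \<phi>) (chart_inv \<phi>)"

definition smooth_atlas :: "('a::topological_space, 'e::euclidean_space) chart set \<Rightarrow> bool" where
  "smooth_atlas A \<longleftrightarrow>
     (\<forall>\<phi>\<in>A. is_chart \<phi>) \<and> (\<Union>\<phi>\<in>A. fst \<phi>) = UNIV \<and>
     (\<forall>\<phi>\<in>A. \<forall>\<psi>\<in>A. smooth_on (snd \<psi> \<circ> chart_inv \<phi>) (snd \<phi> ` (fst \<phi> \<inter> fst \<psi>)))"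

text \<open>The tangent space at \<open>p\<close> is represented by the model space \<open>'e\<close>, a tangent vector being
  identified with its coordinates in one selected chart around \<open>p\<close>. In particular, addition,
  scaling and zero in the tangent space are those of \<open>'e\<close>.\<close>

definition chart_at :: "('a, 'e) chart set \<Rightarrow> 'a \<Rightarrow> ('a, 'e) chart" where
  "chart_at A p = (SOME \<phi>. \<phi> \<in> A \<and> p \<in> fst \<phi>)"

text \<open>The tangent vector at \<open>p\<close> whose coordinates in the chart \<open>\<phi>\<close> around \<open>p\<close> are \<open>u\<close>.\<close>

definition tangent_of_coord ::
  "('a, 'e::euclidean_space) chart set \<Rightarrow> ('a, 'e) chart \<Rightarrow> 'a \<Rightarrow> 'e \<Rightarrow> 'e" where
  "tangent_of_coord A \<phi> p u =
     frechet_derivative (snd (chart_at A p) \<circ> chart_inv \<phi>) (at (snd \<phi> p)) u"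

definition smooth_curve_on ::
  "('a::topological_space, 'e::euclidean_space) chart set \<Rightarrow> (real \<Rightarrow> 'a) \<Rightarrow> real set \<Rightarrow> bool" where
  "smooth_curve_on A c J \<longleftrightarrow>
     continuous_on J c \<and> (\<forall>\<phi>\<in>A. smooth_on (snd \<phi> \<circ> c) {t\<in>J. c t \<in> fst \<phi>})"

definition velocity ::
  "('a, 'e::euclidean_space) chart set \<Rightarrow> (real \<Rightarrow> 'a) \<Rightarrow> real \<Rightarrow> 'e" where
  "velocity A c t = vector_derivative (snd (chart_at A (c t)) \<circ> c) (at t)"

text \<open>Each of the finitely many pieces is smooth up to its endpoints, i.e. it extends to a smooth
  curve on an open set.\<close>

definition piecewise_smooth_curve ::
  "('a::topological_space, 'e::euclidean_space) chart set \<Rightarrow> (real \<Rightarrow> 'a) \<Rightarrow> real \<Rightarrow> real \<Rightarrow> bool" where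
  "piecewise_smooth_curve A c a b \<longleftrightarrow>
     (\<exists>(n::nat) s. s 0 = a \<and> s n = b \<and> (\<forall>i<n. s i < s (Suc i)) \<and>
       (\<forall>i<n. \<exists>c' J. open J \<and> {s i..s (Suc i)} \<subseteq> J \<and> smooth_curve_on A c' J \<and>
          (\<forall>t\<in>{s i..s (Suc i)}. c' t = c t)))"

text \<open>A smooth map with smooth inverse from an open set \<open>U\<close> of the model space onto an open
  subset of the manifold.\<close>

definition diffeo_onto_image ::
  "('a::topological_space, 'e::euclidean_space) chart set \<Rightarrow> ('e \<Rightarrow> 'a) \<Rightarrow> 'e set \<Rightarrow> bool" where
  "diffeo_onto_image A f U \<longleftrightarrow>
     inj_on f U \<and> open (f ` U) \<and> continuous_on U f \<and>
     (\<forall>\<phi>\<in>A. smooth_on (snd \<phi> \<circ> f) {u\<in>U. f u \<in> fst \<phi>}) \<and>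
     (\<forall>\<phi>\<in>A. smooth_on (inv_into U f \<circ> chart_inv \<phi>) (snd \<phi> ` (fst \<phi> \<inter> f ` U)))"


section \<open>Riemannian metrics, length and distance\<close>

text \<open>\<open>g p\<close> is the inner product on the tangent space at \<open>p\<close>; \<open>metric_coord A g \<phi> y\<close> is its
  coordinate expression in the chart \<open>\<phi>\<close> at the coordinate point \<open>y\<close>.\<close>

definition metric_coord ::
  "('a, 'e::euclidean_space) chart set \<Rightarrow> ('a \<Rightarrow> 'e \<Rightarrow> 'e \<Rightarrow> real) \<Rightarrow> ('a, 'e) chart \<Rightarrow> 'e \<Rightarrow> 'e \<Rightarrow> 'e \<Rightarrow> real"
where
  "metric_coord A g \<phi> y u v =
     g (chart_inv \<phi> y) (tangent_of_coord A \<phi> (chart_inv \<phi> y) u) (tangent_of_coord A \<phi> (chart_inv \<phi> y) v)"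

definition riemannian_metric ::
  "('a, 'e::euclidean_space) chart set \<Rightarrow> ('a \<Rightarrow> 'e \<Rightarrow> 'e \<Rightarrow> real) \<Rightarrow> bool" where
  "riemannian_metric A g \<longleftrightarrow>
     (\<forall>p. bilinear (g p) \<and> (\<forall>u v. g p u v = g p v u) \<and> (\<forall>v. v \<noteq> 0 \<longrightarrow> 0 < g p v v)) \<and>
     (\<forall>\<phi>\<in>A. \<forall>u v. smooth_on (\<lambda>y. metric_coord A g \<phi> y u v) (snd \<phi> ` fst \<phi>))"

definition curve_length ::
  "('a, 'e::euclidean_space) chart set \<Rightarrow> ('a \<Rightarrow> 'e \<Rightarrow> 'e \<Rightarrow> real) \<Rightarrow> (real \<Rightarrow> 'a) \<Rightarrow> real \<Rightarrow> real \<Rightarrow> real"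
where
  "curve_length A g c a b =
     integral {a..b} (\<lambda>t. sqrt (g (c t) (velocity A c t) (velocity A c t)))"

definition riem_dist ::
  "('a::topological_space, 'e::euclidean_space) chart set \<Rightarrow> ('a \<Rightarrow> 'e \<Rightarrow> 'e \<Rightarrow> real) \<Rightarrow> 'a \<Rightarrow> 'a \<Rightarrow> real"
where
  "riem_dist A g x y =
     Inf {curve_length A g c 0 1 | c. piecewise_smooth_curve A c 0 1 \<and> c 0 = x \<and> c 1 = y}"

definition complete_riemannian_manifold ::
  "('a::topological_space, 'e::euclidean_space) chart set \<Rightarrow> ('a \<Rightarrow> 'e \<Rightarrow> 'e \<Rightarrow> real) \<Rightarrow> bool" where
  "complete_riemannian_manifold A g \<longleftrightarrow>
     connected (UNIV :: 'a set) \<and> smooth_atlas A \<and> riemannian_metric A g \<and>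
     Metric_space.mcomplete UNIV (riem_dist A g)"


section \<open>Geodesics\<close>

text \<open>A geodesic from \<open>x\<close> to \<open>y\<close> is a curve of minimal length, parametrized over \<open>[0,1]\<close>
  proportionally to arc length. This normalization makes uniqueness of geodesics (which is
  uniqueness up to reparametrization) uniqueness of functions on \<open>[0,1]\<close>.\<close>

definition geodesic_from_to ::
  "('a::topological_space, 'e::euclidean_space) chart set \<Rightarrow> ('a \<Rightarrow> 'e \<Rightarrow> 'e \<Rightarrow> real) \<Rightarrow>
   'a \<Rightarrow> 'a \<Rightarrow> (real \<Rightarrow> 'a) \<Rightarrow> bool"
where
  "geodesic_from_to A g x y c \<longleftrightarrow>
     piecewise_smooth_curve A c 0 1 \<and> c 0 = x \<and> c 1 = y \<and>
     (\<forall>t\<in>{0..1}. curve_length A g c 0 t = t * curve_length A g c 0 1) \<and>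
     curve_length A g c 0 1 = riem_dist A g x y"

definition is_unique_geodesic ::
  "('a::topological_space, 'e::euclidean_space) chart set \<Rightarrow> ('a \<Rightarrow> 'e \<Rightarrow> 'e \<Rightarrow> real) \<Rightarrow>
   'a \<Rightarrow> 'a \<Rightarrow> (real \<Rightarrow> 'a) \<Rightarrow> bool"
where
  "is_unique_geodesic A g x y c \<longleftrightarrow>
     geodesic_from_to A g x y c \<and>
     (\<forall>c'. geodesic_from_to A g x y c' \<longrightarrow> (\<forall>t\<in>{0..1}. c' t = c t))"

text \<open>\<open>metric_deriv A g \<phi> y w u v\<close> is the derivative of \<open>g(u, v)\<close> in the direction \<open>w\<close>, for
  constant coordinate vector fields \<open>u\<close> and \<open>v\<close>. The Christoffel symbol of the Levi-Civita
  connection is then given by the Koszul formula.\<close>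

definition metric_deriv ::
  "('a, 'e::euclidean_space) chart set \<Rightarrow> ('a \<Rightarrow> 'e \<Rightarrow> 'e \<Rightarrow> real) \<Rightarrow> ('a, 'e) chart \<Rightarrow>
   'e \<Rightarrow> 'e \<Rightarrow> 'e \<Rightarrow> 'e \<Rightarrow> real"
where
  "metric_deriv A g \<phi> y w u v = frechet_derivative (\<lambda>z. metric_coord A g \<phi> z u v) (at y) w"

definition christoffel ::
  "('a, 'e::euclidean_space) chart set \<Rightarrow> ('a \<Rightarrow> 'e \<Rightarrow> 'e \<Rightarrow> real) \<Rightarrow> ('a, 'e) chart \<Rightarrow>
   'e \<Rightarrow> 'e \<Rightarrow> 'e \<Rightarrow> 'e"
where
  "christoffel A g \<phi> y u v =
     (THE z. \<forall>w. metric_coord A g \<phi> y z w =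
        (metric_deriv A g \<phi> y u v w + metric_deriv A g \<phi> y v u w - metric_deriv A g \<phi> y w u v) / 2)"

text \<open>The covariant derivative of the velocity of \<open>c\<close> along \<open>c\<close>, in the coordinates of \<open>\<phi>\<close>.\<close>

definition acceleration_coord ::
  "('a, 'e::euclidean_space) chart set \<Rightarrow> ('a \<Rightarrow> 'e \<Rightarrow> 'e \<Rightarrow> real) \<Rightarrow> ('a, 'e) chart \<Rightarrow>
   (real \<Rightarrow> 'a) \<Rightarrow> real \<Rightarrow> 'e"
where
  "acceleration_coord A g \<phi> c t =
     (let y' = (\<lambda>s. vector_derivative (snd \<phi> \<circ> c) (at s))
      in vector_derivative y' (at t) + christoffel A g \<phi> (snd \<phi> (c t)) (y' t) (y' t))"

definition geodesic_on ::
  "('a::topological_space, 'e::euclidean_space) chart set \<Rightarrow> ('a \<Rightarrow> 'e \<Rightarrow> 'e \<Rightarrow> real) \<Rightarrow>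
   (real \<Rightarrow> 'a) \<Rightarrow> real set \<Rightarrow> bool"
where
  "geodesic_on A g c J \<longleftrightarrow>
     smooth_curve_on A c J \<and>
     (\<forall>t\<in>J. \<forall>\<phi>\<in>A. c t \<in> fst \<phi> \<longrightarrow> acceleration_coord A g \<phi> c t = 0)"

text \<open>A closed curve on \<open>[a,b]\<close> is taken as a \<open>(b - a)\<close>-periodic curve on the real line, so that
  being geodesic at every point includes the point where the curve closes up.\<close>

definition closed_geodesic ::
  "('a::topological_space, 'e::euclidean_space) chart set \<Rightarrow> ('a \<Rightarrow> 'e \<Rightarrow> 'e \<Rightarrow> real) \<Rightarrow>
   (real \<Rightarrow> 'a) \<Rightarrow> real \<Rightarrow> real \<Rightarrow> bool"
where
  "closed_geodesic A g c a b \<longleftrightarrow>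
     a < b \<and> (\<forall>t. c (t + (b - a)) = c t) \<and> geodesic_on A g c UNIV"

definition exp_map ::
  "('a::topological_space, 'e::euclidean_space) chart set \<Rightarrow> ('a \<Rightarrow> 'e \<Rightarrow> 'e \<Rightarrow> real) \<Rightarrow> 'a \<Rightarrow> 'e \<Rightarrow> 'a"
where
  "exp_map A g p v =
     (THE q. \<exists>c J. open J \<and> is_interval J \<and> {0..1} \<subseteq> J \<and> geodesic_on A g c J \<and>
        c 0 = p \<and> velocity A c 0 = v \<and> c 1 = q)"

definition tangent_ball :: "('a \<Rightarrow> 'e \<Rightarrow> 'e \<Rightarrow> real) \<Rightarrow> 'a \<Rightarrow> ereal \<Rightarrow> 'e set" where
  "tangent_ball g p \<rho> = {v. ereal (sqrt (g p v v)) < \<rho>}"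

text \<open>The injectivity radius may be infinite.\<close>

definition inj_radius ::
  "('a::topological_space, 'e::euclidean_space) chart set \<Rightarrow> ('a \<Rightarrow> 'e \<Rightarrow> 'e \<Rightarrow> real) \<Rightarrow> 'a \<Rightarrow> ereal"
where
  "inj_radius A g p =
     Sup {ereal \<rho> | \<rho>. 0 < \<rho> \<and> diffeo_onto_image A (exp_map A g p) (tangent_ball g p (ereal \<rho>))}"

definition log_domain ::
  "('a::topological_space, 'e::euclidean_space) chart set \<Rightarrow> ('a \<Rightarrow> 'e \<Rightarrow> 'e \<Rightarrow> real) \<Rightarrow> 'a \<Rightarrow> 'a set"
where
  "log_domain A g p = exp_map A g p ` tangent_ball g p (inj_radius A g p)"

definition log_map ::
  "('a::topological_space, 'e::euclidean_space) chart set \<Rightarrow> ('a \<Rightarrow> 'e \<Rightarrow> 'e \<Rightarrow> real) \<Rightarrow> 'a \<Rightarrow> 'a \<Rightarrow> 'e"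
where
  "log_map A g p q = inv_into (tangent_ball g p (inj_radius A g p)) (exp_map A g p) q"

definition inf_inj_radius ::
  "('a::topological_space, 'e::euclidean_space) chart set \<Rightarrow> ('a \<Rightarrow> 'e \<Rightarrow> 'e \<Rightarrow> real) \<Rightarrow> ereal"
where
  "inf_inj_radius A g = (INF p. inj_radius A g p)"


section \<open>Consensus over a cycle graph\<close>

text \<open>Nodes are \<open>1, \<dots>, N\<close>, with indices modulo \<open>N\<close>.\<close>

definition next_node :: "nat \<Rightarrow> nat \<Rightarrow> nat" where
  "next_node N i = (if i = N then 1 else i + 1)"

definition prev_node :: "nat \<Rightarrow> nat \<Rightarrow> nat" where
  "prev_node N i = (if i = 1 then N else i - 1)"

definition cycle_weights :: "nat \<Rightarrow> (nat \<Rightarrow> nat \<Rightarrow> real) \<Rightarrow> bool" where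
  "cycle_weights N w \<longleftrightarrow>
     (\<forall>i\<in>{1..N}. 0 < w i (next_node N i) \<and> w i (next_node N i) = w (next_node N i) i)"

definition consensus_field ::
  "('a::topological_space, 'e::euclidean_space) chart set \<Rightarrow> ('a \<Rightarrow> 'e \<Rightarrow> 'e \<Rightarrow> real) \<Rightarrow>
   nat \<Rightarrow> (nat \<Rightarrow> nat \<Rightarrow> real) \<Rightarrow> (nat \<Rightarrow> 'a) \<Rightarrow> nat \<Rightarrow> 'e"
where
  "consensus_field A g N w x i =
     w (prev_node N i) i *\<^sub>R log_map A g (x i) (x (prev_node N i)) +
     w i (next_node N i) *\<^sub>R log_map A g (x i) (x (next_node N i))"

text \<open>The right-hand side only makes sense at configurations for which the logarithms are
  defined; this is part of being an equilibrium.\<close>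

definition consensus_equilibrium ::
  "('a::topological_space, 'e::euclidean_space) chart set \<Rightarrow> ('a \<Rightarrow> 'e \<Rightarrow> 'e \<Rightarrow> real) \<Rightarrow>
   nat \<Rightarrow> (nat \<Rightarrow> nat \<Rightarrow> real) \<Rightarrow> (nat \<Rightarrow> 'a) \<Rightarrow> bool"
where
  "consensus_equilibrium A g N w x \<longleftrightarrow>
     (\<forall>i\<in>{1..N}. x (prev_node N i) \<in> log_domain A g (x i) \<and>
                  x (next_node N i) \<in> log_domain A g (x i) \<and>
                  consensus_field A g N w x i = 0)"

text \<open>\<open>c\<close> restricted to \<open>[\<tau> 0, \<tau> N]\<close> is the concatenation of the curves \<open>cs 1, \<dots>, cs N\<close>, where
  \<open>cs i\<close>, given on \<open>[0,1]\<close>, is traversed affinely during \<open>[\<tau> (i - 1), \<tau> i]\<close>.\<close>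

definition is_concatenation ::
  "nat \<Rightarrow> (nat \<Rightarrow> real \<Rightarrow> 'a) \<Rightarrow> (nat \<Rightarrow> real) \<Rightarrow> (real \<Rightarrow> 'a) \<Rightarrow> bool" where
  "is_concatenation N cs \<tau> c \<longleftrightarrow>
     (\<forall>i\<in>{1..N}. \<tau> (i - 1) < \<tau> i \<and>
        (\<forall>s\<in>{0..1}. c (\<tau> (i - 1) + s * (\<tau> i - \<tau> (i - 1))) = cs i s))"

definition splay_state ::
  "('a::topological_space, 'e::euclidean_space) chart set \<Rightarrow> ('a \<Rightarrow> 'e \<Rightarrow> 'e \<Rightarrow> real) \<Rightarrow>
   nat \<Rightarrow> (nat \<Rightarrow> nat \<Rightarrow> real) \<Rightarrow> (nat \<Rightarrow> 'a) \<Rightarrow> bool"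
where
  "splay_state A g N w x \<longleftrightarrow>
     (\<exists>cs \<tau> c.
        (\<forall>i\<in>{1..N}. is_unique_geodesic A g (x i) (x (next_node N i)) (cs i)) \<and>
        is_concatenation N cs \<tau> c \<and>
        closed_geodesic A g c (\<tau> 0) (\<tau> N) \<and>
        (\<exists>\<epsilon>>0. \<forall>i\<in>{1..N}.
           riem_dist A g (x i) (x (next_node N i)) = curve_length A g (cs i) 0 1 \<and>
           curve_length A g (cs i) 0 1 =
             inverse (w i (next_node N i)) / (\<Sum>j\<in>{1..N}. inverse (w j (next_node N j))) *
             curve_length A g c (\<tau> 0) (\<tau> N) \<and>
           ereal (curve_length A g (cs i) 0 1) < inf_inj_radius A g - ereal \<epsilon>))"

end

theory Submission
  imports Defs
begin

text \<open>
  Let \<open>V\<close> be the velocity of the closed geodesic \<open>c\<close> at the node \<open>x i\<close>. The piece leading to the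
  next node takes time \<open>d i\<close>, and the piece coming from the previous node \<open>j\<close> takes time \<open>d j\<close>. Because
  \<open>c\<close> is geodesic across the node, both neighbours lie on the same geodesic through \<open>x i\<close>: the next one
  is the exponential of \<open>d i *\<^sub>R V\<close>, the previous one is the exponential of \<open>- d j *\<^sub>R V\<close>. The norms of
  these two vectors are the lengths of the two pieces, which are below the injectivity radius, so
  the vectors are the logarithms. In a splay state the length of a piece is inversely proportional to
  the weight of its edge. The weighted logarithms therefore have the same norm and opposite
  directions, and they cancel. (If \<open>V\<close> is zero, then both logarithms are.)

  Two points of this argument need analysis. The first is that following a geodesic computes the
  exponential map (\<open>exp_map_eq\<close>), which requires that a geodesic is determined by its initial velocity
  (\<open>geodesic_uniqueness\<close>). In a chart, the geodesic equation is a first-order differential equation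
  whose right-hand side, the geodesic spray, is locally Lipschitz (\<open>geodesic_spray_lipschitz_near\<close>). The
  Christoffel symbols are given only implicitly by the Koszul formula; their Lipschitz continuity is
  an instance of \<open>lipschitz_near_implicit_linear\<close>. Local uniqueness is then a Gronwall
  argument (\<open>ode_local_uniqueness\<close>), and connectedness of the parameter interval makes it global.

  The second point is that the lengths of the pieces are the norms at the node. Each piece is
  parametrized proportionally to arc length, and the speed of \<open>c\<close> is continuous, so the speed at the ends
  of a piece can be read off from its length (\<open>speed_of_proportional_parametrization\<close>).
\<close>

section \<open>Smooth maps between Euclidean spaces\<close>

lemma Ck_on_cong:
  assumes "open S" "Ck_on k f S" "\<And>x. x \<in> S \<Longrightarrow> f x = g x"
  shows "Ck_on k g S"
  using assms
proof (induction k arbitrary: f g)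
  case 0
  then show ?case by (simp cong: continuous_on_cong)
next
  case (Suc k)
  have diff: "g differentiable at x \<and> frechet_derivative f (at x) = frechet_derivative g (at x)"
    if "x \<in> S" for x
  proof -
    from Suc.prems that have "f differentiable at x" by simp
    then have "(g has_derivative frechet_derivative f (at x)) (at x)"
      using Suc.prems that has_derivative_transform_within_open[of f _ x UNIV S g]
      by (simp add: frechet_derivative_works)
    then show ?thesis
      using differentiableI frechet_derivative_at by blast
  qed
  then show ?case
    using Suc.prems Suc.IH[OF \<open>open S\<close>, of "\<lambda>x. frechet_derivative f (at x) v"
        "\<lambda>x. frechet_derivative g (at x) v" for v] by auto
qed

text \<open>Reparametrized curves are handled through their chart expressions, so only functions of one
  real variable are needed. The induction is on the order of differentiability: the directional
  derivative of the composite is again an affine reparametrization, of the directional derivative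
  in the direction \<open>v * b\<close>.\<close>

lemma Ck_on_affine_reparam:
  fixes f :: "real \<Rightarrow> 'b::euclidean_space"
  assumes "open S" "Ck_on k f S"
  shows "Ck_on k (\<lambda>s. f (a + s * b)) {s. a + s * b \<in> S}"
  using assms(2)
proof (induction k arbitrary: f)
  case 0
  then show ?case
    by (auto intro!: continuous_on_compose2[of S f] continuous_intros)
next
  case (Suc k)
  have der: "((\<lambda>s. f (a + s * b)) has_derivative
      (\<lambda>h. frechet_derivative f (at (a + s * b)) (h * b))) (at s)" if "a + s * b \<in> S" for s
  proof -
    have "(f has_derivative frechet_derivative f (at (a + s * b))) (at (a + s * b))"
      using Suc.prems that by (simp add: frechet_derivative_works)
    moreover have "((\<lambda>s. a + s * b) has_derivative (\<lambda>h. h * b)) (at s)"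
      by (auto intro!: derivative_eq_intros)
    ultimately show ?thesis
      by (rule has_derivative_compose[where f = "\<lambda>s. a + s * b" and g = f, rotated])
  qed
  have "open {s. a + s * b \<in> S}"
    using open_vimage[OF \<open>open S\<close>, of "\<lambda>s. a + s * b"] by (simp add: vimage_def continuous_intros)
  then have "Ck_on k (\<lambda>s. frechet_derivative (\<lambda>s. f (a + s * b)) (at s) v) {s. a + s * b \<in> S}" for v
  proof (rule Ck_on_cong)
    show "Ck_on k (\<lambda>s. frechet_derivative f (at (a + s * b)) (v * b)) {s. a + s * b \<in> S}"
      using Suc.prems Suc.IH[of "\<lambda>x. frechet_derivative f (at x) (v * b)"] by simp
  qed (use der fun_cong[OF frechet_derivative_at] in blast)
  with der show ?case by (auto simp: differentiable_def)
qed

lemma has_vector_derivative_affine_reparam: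
  assumes "(f has_vector_derivative D) (at (a + s * b))"
  shows "((\<lambda>s. f (a + s * b)) has_vector_derivative b *\<^sub>R D) (at s)"
proof -
  have "((\<lambda>s. a + s * b) has_vector_derivative b) (at s)"
    by (auto intro!: derivative_eq_intros simp: has_real_derivative_iff_has_vector_derivative[symmetric])
  from vector_diff_chain_at[OF this assms] show ?thesis by (simp add: comp_def)
qed

lemma smooth_on_affine_reparam:
  fixes f :: "real \<Rightarrow> 'b::euclidean_space"
  assumes "open S" "smooth_on f S"
  shows "smooth_on (\<lambda>s. f (a + s * b)) {s. a + s * b \<in> S}"
  using assms Ck_on_affine_reparam unfolding smooth_on_def by blast

lemma smooth_on_has_derivative:
  assumes "smooth_on f S" "x \<in> S"
  shows "(f has_derivative frechet_derivative f (at x)) (at x)"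
proof -
  have "Ck_on (Suc 0) f S" using assms(1) unfolding smooth_on_def by blast
  then show ?thesis using assms(2) by (simp add: frechet_derivative_works)
qed

lemma smooth_on_continuous:
  assumes "smooth_on f S"
  shows "continuous_on S f"
proof -
  have "Ck_on 0 f S" using assms unfolding smooth_on_def by blast
  then show ?thesis by simp
qed

lemma smooth_on_frechet_derivative:
  assumes "smooth_on f S"
  shows "smooth_on (\<lambda>x. frechet_derivative f (at x) v) S"
  unfolding smooth_on_def
proof
  fix k
  have "Ck_on (Suc k) f S" using assms unfolding smooth_on_def by blast
  then show "Ck_on k (\<lambda>x. frechet_derivative f (at x) v) S" by simp
qed

text \<open>For a curve, the Frechet derivative in direction \<open>1\<close> is the vector derivative, which turns the
  recursive definition of smoothness into statements about velocity and acceleration.\<close>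

lemma smooth_curve_derivatives:
  fixes y :: "real \<Rightarrow> 'b::euclidean_space"
  assumes "open S" "smooth_on y S" "t \<in> S"
  shows "(y has_vector_derivative vector_derivative y (at t)) (at t)"
    and "((\<lambda>s. vector_derivative y (at s)) has_vector_derivative
           vector_derivative (\<lambda>s. vector_derivative y (at s)) (at t)) (at t)"
    and "continuous_on S (\<lambda>s. vector_derivative y (at s))"
proof -
  have D: "(y has_vector_derivative frechet_derivative y (at s) 1) (at s)" if "s \<in> S" for s
  proof -
    note d = smooth_on_has_derivative[OF assms(2) that]
    have "frechet_derivative y (at s) h = h *\<^sub>R frechet_derivative y (at s) 1" for h
      using linear_cmul[OF has_derivative_linear[OF d], of h 1] by (metis mult.right_neutral real_scaleR_def)
    then have "frechet_derivative y (at s) = (\<lambda>h. h *\<^sub>R frechet_derivative y (at s) 1)" ..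
    with d show ?thesis unfolding has_vector_derivative_def by metis
  qed
  then have eq: "vector_derivative y (at s) = frechet_derivative y (at s) 1" if "s \<in> S" for s
    using that vector_derivative_at by blast
  have S1: "smooth_on (\<lambda>s. vector_derivative y (at s)) S"
    unfolding smooth_on_def
  proof
    fix k
    have "Ck_on k (\<lambda>s. frechet_derivative y (at s) 1) S"
      using smooth_on_frechet_derivative[OF assms(2)] unfolding smooth_on_def by blast
    then show "Ck_on k (\<lambda>s. vector_derivative y (at s)) S"
      by (rule Ck_on_cong[OF assms(1)]) (simp add: eq)
  qed
  show "(y has_vector_derivative vector_derivative y (at t)) (at t)"
    using D eq assms by simp
  show "continuous_on S (\<lambda>s. vector_derivative y (at s))"
    using S1 smooth_on_continuous by blast
  show "((\<lambda>s. vector_derivative y (at s)) has_vector_derivative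
           vector_derivative (\<lambda>s. vector_derivative y (at s)) (at t)) (at t)"
    using smooth_on_has_derivative[OF S1 assms(3)] differentiableI vector_derivative_works by blast
qed

section \<open>Locally Lipschitz maps\<close>

text \<open>The predicate is tied to a point and asks for one neighbourhood only, so that finitely many such
  neighbourhoods can be intersected; this is what makes it stable under sums and products.\<close>

definition lipschitz_near :: "('p::metric_space \<Rightarrow> 'q::metric_space) \<Rightarrow> 'p \<Rightarrow> bool" where
  "lipschitz_near f x \<longleftrightarrow> (\<exists>U L. open U \<and> x \<in> U \<and> L-lipschitz_on U f)"

lemma lipschitz_nearI: "open U \<Longrightarrow> x \<in> U \<Longrightarrow> L-lipschitz_on U f \<Longrightarrow> lipschitz_near f x"
  unfolding lipschitz_near_def by blast

lemma finite_lipschitz_near: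
  fixes f :: "'i \<Rightarrow> 'p::metric_space \<Rightarrow> 'q::real_normed_vector"
  assumes "finite I" "\<And>i. i \<in> I \<Longrightarrow> lipschitz_near (f i) x"
  shows "\<exists>U L. open U \<and> x \<in> U \<and> 0 \<le> L \<and>
    (\<forall>i\<in>I. L-lipschitz_on U (f i) \<and> (\<forall>y\<in>U. norm (f i y) \<le> L))"
  using assms
proof (induction I)
  case empty
  then show ?case by (intro exI[of _ UNIV] exI[of _ 0]) auto
next
  case (insert i I)
  then obtain U L where U: "open U" "x \<in> U" "0 \<le> L"
    "\<forall>i\<in>I. L-lipschitz_on U (f i) \<and> (\<forall>y\<in>U. norm (f i y) \<le> L)" by auto
  have "lipschitz_near (f i) x" using insert.prems by blast
  then obtain V M where V: "open V" "x \<in> V" "M-lipschitz_on V (f i)"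
    unfolding lipschitz_near_def by blast
  let ?W = "U \<inter> (V \<inter> ball x 1)" and ?B = "L + M + norm (f i x)"
  have M: "0 \<le> M" using V lipschitz_on_nonneg by blast
  have "norm (f i y) \<le> ?B" if "y \<in> ?W" for y
  proof -
    have "norm (f i y - f i x) \<le> M * dist y x"
      using lipschitz_onD[OF V(3), of y x] that V by (simp add: dist_norm)
    also have "\<dots> \<le> M * 1"
      using that M by (intro mult_left_mono) (auto simp: dist_commute)
    finally show ?thesis using U norm_triangle_sub[of "f i y" "f i x"] by linarith
  qed
  moreover have "?B-lipschitz_on ?W (f i)"
    by (rule lipschitz_on_mono[OF V(3)]) (use U in auto)
  moreover have "?B-lipschitz_on ?W (f j) \<and> (\<forall>y\<in>?W. norm (f j y) \<le> ?B)" if "j \<in> I" for j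
  proof -
    have "L-lipschitz_on U (f j)" "\<forall>y\<in>U. norm (f j y) \<le> L" using U(4) that by blast+
    then show ?thesis
      using M norm_ge_zero[of "f i x"] by (auto intro: lipschitz_on_mono simp: add_increasing2)
  qed
  ultimately show ?case
    using U V M by (intro exI[of _ ?W] exI[of _ ?B]) auto
qed

lemma lipschitz_near_const: "lipschitz_near (\<lambda>x. c) x"
  by (rule lipschitz_nearI[of UNIV _ 0]) (auto intro: lipschitz_intros)

lemma lipschitz_near_add:
  fixes f g :: "'p::metric_space \<Rightarrow> 'q::real_normed_vector"
  assumes "lipschitz_near f x" "lipschitz_near g x"
  shows "lipschitz_near (\<lambda>x. f x + g x) x"
proof -
  obtain U L V M where *: "open U" "x \<in> U" "L-lipschitz_on U f" "open V" "x \<in> V" "M-lipschitz_on V g"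
    using assms unfolding lipschitz_near_def by blast
  show ?thesis
    by (rule lipschitz_nearI[of "U \<inter> V" _ "L + M"])
      (use * in \<open>auto intro!: lipschitz_on_add intro: lipschitz_on_subset\<close>)
qed

lemma lipschitz_near_sum:
  fixes f :: "'i \<Rightarrow> 'p::metric_space \<Rightarrow> 'q::real_normed_vector"
  assumes "\<And>i. i \<in> I \<Longrightarrow> lipschitz_near (f i) x"
  shows "lipschitz_near (\<lambda>x. \<Sum>i\<in>I. f i x) x"
  using assms
  by (induction I rule: infinite_finite_induct) (auto intro: lipschitz_near_const lipschitz_near_add)

lemma lipschitz_near_mult:
  fixes f g :: "'p::metric_space \<Rightarrow> real"
  assumes "lipschitz_near f x" "lipschitz_near g x"
  shows "lipschitz_near (\<lambda>x. f x * g x) x"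
proof -
  have "\<exists>U L. open U \<and> x \<in> U \<and> 0 \<le> L \<and>
      (\<forall>h\<in>{f, g}. L-lipschitz_on U h \<and> (\<forall>y\<in>U. norm (h y) \<le> L))"
    by (rule finite_lipschitz_near) (use assms in auto)
  then obtain U L where U: "open U" "x \<in> U" "0 \<le> L"
    and lip: "L-lipschitz_on U f" "L-lipschitz_on U g"
    and bd: "\<forall>y\<in>U. norm (f y) \<le> L" "\<forall>y\<in>U. norm (g y) \<le> L"
    by auto
  show ?thesis
  proof (rule lipschitz_nearI[OF U(1,2)], rule lipschitz_onI)
    fix y z assume yz: "y \<in> U" "z \<in> U"
    have f: "\<bar>f y - f z\<bar> \<le> L * dist y z" "\<bar>f y\<bar> \<le> L"
      using lipschitz_onD[OF lip(1) yz] bd(1) yz by (auto simp: dist_norm)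
    have g: "\<bar>g y - g z\<bar> \<le> L * dist y z" "\<bar>g z\<bar> \<le> L"
      using lipschitz_onD[OF lip(2) yz] bd(2) yz by (auto simp: dist_norm)
    have "f y * g y - f z * g z = f y * (g y - g z) + (f y - f z) * g z" by algebra
    then have "\<bar>f y * g y - f z * g z\<bar> \<le> \<bar>f y\<bar> * \<bar>g y - g z\<bar> + \<bar>f y - f z\<bar> * \<bar>g z\<bar>"
      by (metis abs_mult abs_triangle_ineq)
    also have "\<dots> \<le> L * (L * dist y z) + (L * dist y z) * L"
      using f g U by (intro add_mono mult_mono) auto
    finally show "dist (f y * g y) (f z * g z) \<le> (2 * L * L) * dist y z"
      by (simp add: dist_norm algebra_simps)
  qed (use U in auto)
qed

lemma lipschitz_near_compose_lipschitz:
  assumes "lipschitz_near f (h x)" "L-lipschitz_on UNIV h"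
  shows "lipschitz_near (\<lambda>x. f (h x)) x"
proof -
  obtain U M where U: "open U" "h x \<in> U" "M-lipschitz_on U f"
    using assms unfolding lipschitz_near_def by blast
  show ?thesis
  proof (rule lipschitz_nearI)
    show "open (h -` U)"
      using U open_vimage lipschitz_on_continuous_on[OF assms(2)] by blast
    have "M-lipschitz_on (h ` (h -` U)) f"
      using U(3) by (rule lipschitz_on_subset) auto
    with lipschitz_on_compose2[OF lipschitz_on_subset[OF assms(2), of "h -` U"] this]
    show "(M * L)-lipschitz_on (h -` U) (\<lambda>x. f (h x))" by simp
  qed (use U in auto)
qed

lemma lipschitz_near_bounded_linear:
  assumes "bounded_linear f"
  shows "lipschitz_near f x"
proof -
  obtain L where "L-lipschitz_on UNIV f"
    using bounded_linear.lipschitz_boundE[OF assms] by metis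
  then show ?thesis by (auto intro: lipschitz_nearI)
qed

lemma lipschitz_near_Pair:
  assumes "lipschitz_near f x" "lipschitz_near g x"
  shows "lipschitz_near (\<lambda>x. (f x, g x)) x"
proof -
  obtain U L V M where *: "open U" "x \<in> U" "L-lipschitz_on U f" "open V" "x \<in> V" "M-lipschitz_on V g"
    using assms unfolding lipschitz_near_def by blast
  show ?thesis
    by (rule lipschitz_nearI[of "U \<inter> V" _ "sqrt (L\<^sup>2 + M\<^sup>2)"])
      (use * in \<open>auto intro!: lipschitz_on_Pair intro: lipschitz_on_subset\<close>)
qed

lemma lipschitz_near_cong:
  assumes "lipschitz_near f x" "open X" "x \<in> X" "\<And>y. y \<in> X \<Longrightarrow> f y = g y"
  shows "lipschitz_near g x"
proof -
  obtain U L where U: "open U" "x \<in> U" "L-lipschitz_on U f"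
    using assms unfolding lipschitz_near_def by blast
  then have "L-lipschitz_on (U \<inter> X) f" by (auto intro: lipschitz_on_subset)
  then have "L-lipschitz_on (U \<inter> X) g"
    by (rule lipschitz_on_transform) (use assms(4) in auto)
  then show ?thesis using U assms by (intro lipschitz_nearI[of "U \<inter> X"]) auto
qed

lemma linear_norm_le_sum_Basis:
  fixes f :: "'a::euclidean_space \<Rightarrow> 'b::real_normed_vector"
  assumes "linear f"
  shows "norm (f u) \<le> norm u * (\<Sum>b\<in>Basis. norm (f b))"
proof -
  have "f u = (\<Sum>b\<in>Basis. (u \<bullet> b) *\<^sub>R f b)"
    by (subst (1) euclidean_representation[of u, symmetric])
      (simp add: linear_sum[OF assms] linear_cmul[OF assms])
  also have "norm \<dots> \<le> (\<Sum>b\<in>Basis. norm u * norm (f b))"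
    by (rule sum_norm_le) (auto simp: intro!: mult_right_mono Basis_le_norm)
  finally show ?thesis by (simp add: sum_distrib_left)
qed

text \<open>The operator norm of the derivative is bounded by the sum of its values on the basis vectors. These
  finitely many continuous functions are bounded near the point, and the mean value inequality on a
  ball applies.\<close>

lemma smooth_imp_lipschitz_near:
  fixes f :: "'a::euclidean_space \<Rightarrow> 'b::euclidean_space"
  assumes "open S" "smooth_on f S" "x \<in> S"
  shows "lipschitz_near f x"
proof -
  have "\<forall>b\<in>Basis. \<forall>\<^sub>F y in nhds x. norm (frechet_derivative f (at y) b) < norm (frechet_derivative f (at x) b) + 1"
  proof
    fix b :: 'a
    have "continuous_on S (\<lambda>y. norm (frechet_derivative f (at y) b))"
      using smooth_on_continuous[OF smooth_on_frechet_derivative[OF assms(2)]]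
      by (intro continuous_on_norm)
    then have "isCont (\<lambda>y. norm (frechet_derivative f (at y) b)) x"
      using assms continuous_on_eq_continuous_at by blast
    then have "((\<lambda>y. norm (frechet_derivative f (at y) b)) \<longlongrightarrow> norm (frechet_derivative f (at x) b)) (nhds x)"
      using isCont_def tendsto_at_iff_tendsto_nhds by blast
    then show "\<forall>\<^sub>F y in nhds x. norm (frechet_derivative f (at y) b) < norm (frechet_derivative f (at x) b) + 1"
      by (rule order_tendstoD) simp
  qed
  then have "\<forall>\<^sub>F y in nhds x. \<forall>b\<in>Basis. norm (frechet_derivative f (at y) b) < norm (frechet_derivative f (at x) b) + 1"
    by (intro eventually_ball_finite) auto
  then have "\<forall>\<^sub>F y in nhds x. y \<in> S \<and> (\<forall>b\<in>Basis. norm (frechet_derivative f (at y) b) < norm (frechet_derivative f (at x) b) + 1)"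
    using assms by (intro eventually_conj eventually_nhds_in_open)
  then obtain e where e: "0 < e" "\<And>y. dist y x < e \<Longrightarrow> y \<in> S \<and>
      (\<forall>b\<in>Basis. norm (frechet_derivative f (at y) b) < norm (frechet_derivative f (at x) b) + 1)"
    unfolding eventually_nhds_metric by blast
  define B where "B = (\<Sum>b\<in>(Basis::'a set). norm (frechet_derivative f (at x) b) + 1)"
  show ?thesis
  proof (rule lipschitz_nearI[of "ball x e" x B], goal_cases)
    case 3
    show ?case
    proof (rule lipschitz_onI)
      show "0 \<le> B" unfolding B_def by (intro sum_nonneg) auto
      fix y z assume yz: "y \<in> ball x e" "z \<in> ball x e"
      have "norm (f y - f z) \<le> B * norm (y - z)"
      proof (rule differentiable_bound[OF convex_ball[of x e] _ _ yz])
        fix u assume u: "u \<in> ball x e"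
        then have uS: "u \<in> S" using e(2)[of u] by (simp add: dist_commute)
        show D: "(f has_derivative frechet_derivative f (at u)) (at u within ball x e)"
          using smooth_on_has_derivative[OF assms(2) uS] has_derivative_at_withinI by blast
        show "onorm (frechet_derivative f (at u)) \<le> B"
        proof (rule onorm_le)
          fix h
          have "norm (frechet_derivative f (at u) h) \<le>
              norm h * (\<Sum>b\<in>Basis. norm (frechet_derivative f (at u) b))"
            using linear_norm_le_sum_Basis has_derivative_linear[OF D] by blast
          also have "\<dots> \<le> norm h * B"
            unfolding B_def using e(2)[of u] u
            by (intro mult_left_mono sum_mono) (auto simp: dist_commute less_imp_le)
          finally show "norm (frechet_derivative f (at u) h) \<le> B * norm h" by (simp add: mult.commute)
        qed
      qed
      then show "dist (f y) (f z) \<le> B * dist y z" by (simp add: dist_norm)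
    qed
  qed (use e in auto)
qed

section \<open>Linear equations with locally Lipschitz coefficients\<close>

lemma bilinear_expand_Basis:
  fixes B :: "'e::euclidean_space \<Rightarrow> 'e \<Rightarrow> real"
  assumes "bilinear B"
  shows "B u v = (\<Sum>b\<in>Basis. \<Sum>b'\<in>Basis. (u \<bullet> b) * (v \<bullet> b') * B b b')"
proof -
  have lin: "linear (B a)" "linear (\<lambda>u. B u a)" for a using assms by (auto simp: bilinear_def)
  have "B u v = (\<Sum>b\<in>Basis. (u \<bullet> b) * B b v)"
    by (subst (1) euclidean_representation[of u, symmetric])
      (simp add: linear_sum[OF lin(2)] linear_cmul[OF lin(2)])
  also have "\<dots> = (\<Sum>b\<in>Basis. (u \<bullet> b) * (\<Sum>b'\<in>Basis. (v \<bullet> b') * B b b'))"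
  proof (intro sum.cong refl arg_cong2[of _ _ _ _ "(*)"])
    fix b
    show "B b v = (\<Sum>b'\<in>Basis. (v \<bullet> b') * B b b')"
      by (subst (1) euclidean_representation[of v, symmetric])
        (simp add: linear_sum[OF lin(1)] linear_cmul[OF lin(1)])
  qed
  finally show ?thesis by (simp add: sum_distrib_left mult.assoc)
qed

text \<open>Existence of the Christoffel symbols: the map from a vector to its inner products with the basis
  vectors is linear and, by definiteness, injective, hence onto.\<close>

lemma posdef_riesz:
  fixes B :: "'e::euclidean_space \<Rightarrow> 'e \<Rightarrow> real"
  assumes "bilinear B" "\<And>v. v \<noteq> 0 \<Longrightarrow> 0 < B v v" "linear K"
  shows "\<exists>!z. \<forall>w. B z w = K w"
proof -
  have lin: "linear (B a)" "linear (\<lambda>u. B u a)" for a using assms(1) by (auto simp: bilinear_def)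
  define f where "f z = (\<Sum>b\<in>Basis. B z b *\<^sub>R b)" for z
  have fb: "f z \<bullet> b = B z b" if "b \<in> Basis" for z b
    unfolding f_def using that by (simp add: inner_sum_left inner_Basis if_distrib sum.delta cong: if_cong)
  have ext: "B z = h" if "linear h" "\<And>b. b \<in> Basis \<Longrightarrow> B z b = h b" for z h
    using linear_eq_stdbasis[OF lin(1) that(1)] that(2) by blast
  have "linear f"
    unfolding linear_iff f_def
    by (simp add: linear_add[OF lin(2)] linear_cmul[OF lin(2)] scaleR_add_left sum.distrib scaleR_sum_right)
  moreover have "inj f"
    unfolding linear_injective_0[OF \<open>linear f\<close>]
  proof (intro allI impI)
    fix z assume "f z = 0"
    then have "B z b = 0" if "b \<in> Basis" for b using fb[OF that, of z] by simp
    then have "B z = (\<lambda>_. 0)" by (intro ext) (auto simp: linear_zero)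
    then show "z = 0" using assms(2)[of z] by fastforce
  qed
  ultimately have "surj f" by (rule linear_injective_imp_surjective) simp
  then obtain z where z: "f z = (\<Sum>b\<in>Basis. K b *\<^sub>R b)" by (metis surjD)
  have "B z b = K b" if "b \<in> Basis" for b
    using fb[OF that, of z] that unfolding z
    by (simp add: inner_sum_left inner_Basis if_distrib sum.delta cong: if_cong)
  then have "B z = K" using ext assms(3) by blast
  moreover have "z' = z" if "\<forall>w. B z' w = K w" for z'
  proof -
    have "B (z' - z) (z' - z) = 0"
      using that \<open>B z = K\<close> by (simp add: bilinear_lsub[OF assms(1)])
    then show ?thesis using assms(2)[of "z' - z"] by fastforce
  qed
  ultimately show ?thesis by (intro ex1I[of _ z]) auto
qed

lemma bilinear_norm_le_sum_Basis:
  fixes f :: "'a::euclidean_space \<Rightarrow> 'a \<Rightarrow> real"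
  assumes "bilinear f"
  shows "\<bar>f u v\<bar> \<le> norm u * norm v * (\<Sum>b\<in>Basis. \<Sum>b'\<in>Basis. \<bar>f b b'\<bar>)"
proof -
  have lin: "linear (f u)" "linear (\<lambda>u. f u v)" for u v
    using assms by (auto simp: bilinear_def)
  have "\<bar>f u v\<bar> \<le> norm u * (\<Sum>b\<in>Basis. \<bar>f b v\<bar>)"
    using linear_norm_le_sum_Basis[OF lin(2)] by simp
  also have "\<dots> \<le> norm u * (\<Sum>b\<in>Basis. norm v * (\<Sum>b'\<in>Basis. \<bar>f b b'\<bar>))"
    using linear_norm_le_sum_Basis[OF lin(1)] by (intro mult_left_mono sum_mono) auto
  finally show ?thesis by (simp add: sum_distrib_left mult.assoc)
qed

text \<open>At the point itself the constant is the minimum of the form over the compact unit sphere. Nearby forms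
  differ little in their finitely many coefficients, so half of that minimum still works.\<close>

lemma bilinear_posdef_coercive_near:
  fixes G :: "'p::metric_space \<Rightarrow> 'e::euclidean_space \<Rightarrow> 'e \<Rightarrow> real"
  assumes "open X" "x0 \<in> X"
    and bil: "\<And>x. x \<in> X \<Longrightarrow> bilinear (G x)"
    and pos: "\<And>v. v \<noteq> 0 \<Longrightarrow> 0 < G x0 v v"
    and lip: "\<And>b b'. b \<in> Basis \<Longrightarrow> b' \<in> Basis \<Longrightarrow> lipschitz_near (\<lambda>x. G x b b') x0"
  shows "\<exists>U l. open U \<and> x0 \<in> U \<and> U \<subseteq> X \<and> 0 < l \<and> (\<forall>x\<in>U. \<forall>v. l * (norm v)\<^sup>2 \<le> G x v v)"
proof -
  obtain b0 :: 'e where b0: "b0 \<in> Basis" using nonempty_Basis by blast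
  have cont: "continuous_on (sphere 0 1) (\<lambda>v. G x0 v v)"
    using bilinear_continuous_on_compose[OF continuous_on_id continuous_on_id bil[OF assms(2)]] by simp
  have "sphere 0 1 \<noteq> ({}::'e set)" using b0 by (auto intro!: exI[of _ b0])
  then obtain v0 where v0: "norm v0 = 1" "\<And>v. norm v = 1 \<Longrightarrow> G x0 v0 v0 \<le> G x0 v v"
    using continuous_attains_inf[OF compact_sphere _ cont] by auto
  define m where "m = G x0 v0 v0"
  have m: "0 < m" unfolding m_def using pos[of v0] v0(1) by (cases "v0 = 0") auto
  have low: "m * (norm v)\<^sup>2 \<le> G x0 v v" for v
  proof (cases "v = 0")
    case True
    then show ?thesis using bilinear_lzero[OF bil[OF assms(2)]] by simp
  next
    case False
    then have "m \<le> G x0 (v /\<^sub>R norm v) (v /\<^sub>R norm v)"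
      unfolding m_def by (intro v0(2)) auto
    also have "\<dots> = G x0 v v / (norm v)\<^sup>2"
      using bilinear_lmul[OF bil[OF assms(2)]] bilinear_rmul[OF bil[OF assms(2)]]
      by (simp add: power2_eq_square divide_inverse)
    finally show ?thesis using False by (simp add: pos_le_divide_eq)
  qed
  define n where "n = (\<Sum>b\<in>(Basis::'e set). \<Sum>b'\<in>(Basis::'e set). (1::real))"
  have n: "0 < n" unfolding n_def by simp
  have "\<exists>V L. open V \<and> x0 \<in> V \<and> 0 \<le> L \<and> (\<forall>i\<in>Basis \<times> Basis.
      L-lipschitz_on V (\<lambda>x. G x (fst i) (snd i)) \<and> (\<forall>y\<in>V. norm (G y (fst i) (snd i)) \<le> L))"
    by (rule finite_lipschitz_near) (use lip in auto)
  then obtain V L where V: "open V" "x0 \<in> V" "0 \<le> L" and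
    VL: "\<forall>i\<in>Basis \<times> Basis. L-lipschitz_on V (\<lambda>x. G x (fst i) (snd i))"
    by blast
  \<comment> \<open>The radius at which the coefficients of the form vary by at most \<open>m / (2 * n)\<close>;
    \<open>L + 1\<close> avoids a division by zero.\<close>
  define d where "d = m / (2 * n * (L + 1))"
  have d: "0 < d" unfolding d_def using m n V by auto
  have "m / 2 * (norm v)\<^sup>2 \<le> G x v v" if x: "x \<in> X \<inter> V \<inter> ball x0 d" for x v
  proof -
    have "bilinear (\<lambda>u v. G x0 u v - G x u v)"
      using bil[of x] bil[OF assms(2)] x unfolding bilinear_def by (auto intro: linear_compose_sub)
    from bilinear_norm_le_sum_Basis[OF this, of v v]
    have "\<bar>G x0 v v - G x v v\<bar> \<le> (norm v)\<^sup>2 * (\<Sum>b\<in>Basis. \<Sum>b'\<in>Basis. \<bar>G x0 b b' - G x b b'\<bar>)"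
      by (simp add: power2_eq_square)
    also have "\<dots> \<le> (norm v)\<^sup>2 * (\<Sum>b\<in>(Basis::'e set). \<Sum>b'\<in>(Basis::'e set). (L + 1) * d * 1)"
    proof (intro mult_left_mono sum_mono)
      fix b b' :: 'e assume b: "b \<in> Basis" "b' \<in> Basis"
      have "\<bar>G x0 b b' - G x b b'\<bar> \<le> L * dist x0 x"
        using lipschitz_onD[OF bspec[OF VL, of "(b, b')"], of x0 x] b x V by (auto simp: dist_norm)
      also have "\<dots> \<le> (L + 1) * d" using x V by (intro mult_mono) auto
      finally show "\<bar>G x0 b b' - G x b b'\<bar> \<le> (L + 1) * d * 1" by simp
    qed auto
    also have "\<dots> = (norm v)\<^sup>2 * ((L + 1) * d * n)"
      unfolding n_def sum_distrib_left ..
    also have "(L + 1) * d * n = m / 2"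
      unfolding d_def using n V by (simp add: field_simps add_nonneg_eq_0_iff)
    finally have "\<bar>G x0 v v - G x v v\<bar> \<le> m / 2 * (norm v)\<^sup>2" by (simp add: mult.commute)
    moreover have "m * (norm v)\<^sup>2 = m / 2 * (norm v)\<^sup>2 + m / 2 * (norm v)\<^sup>2" by simp
    ultimately show ?thesis using low[of v] unfolding abs_le_iff by linarith
  qed
  then show ?thesis
    using assms(1,2) V d m by (intro exI[of _ "X \<inter> V \<inter> ball x0 d"] exI[of _ "m / 2"]) auto
qed

text \<open>Christoffel symbols are only characterized by the linear system that they solve, and this lemma gives
  their regularity without a formula for the inverse matrix. Testing the equation with the solution
  itself bounds the solution by coercivity. For two parameters, the difference of the solutions is
  tested with itself; the right-hand side is then controlled by the Lipschitz bounds on the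
  coefficients and by the bound on the solution.\<close>

lemma lipschitz_near_implicit_linear:
  fixes G :: "'p::metric_space \<Rightarrow> 'e::euclidean_space \<Rightarrow> 'e \<Rightarrow> real"
    and K :: "'p \<Rightarrow> 'e \<Rightarrow> real" and z :: "'p \<Rightarrow> 'e"
  assumes "open X" "x0 \<in> X"
    and bil: "\<And>x. x \<in> X \<Longrightarrow> bilinear (G x)"
    and pos: "\<And>v. v \<noteq> 0 \<Longrightarrow> 0 < G x0 v v"
    and lin: "\<And>x. x \<in> X \<Longrightarrow> linear (K x)"
    and G: "\<And>b b'. b \<in> Basis \<Longrightarrow> b' \<in> Basis \<Longrightarrow> lipschitz_near (\<lambda>x. G x b b') x0"
    and K: "\<And>b. b \<in> Basis \<Longrightarrow> lipschitz_near (\<lambda>x. K x b) x0"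
    and z: "\<And>x w. x \<in> X \<Longrightarrow> G x (z x) w = K x w"
  shows "lipschitz_near z x0"
proof -
  have "\<exists>U l. open U \<and> x0 \<in> U \<and> U \<subseteq> X \<and> 0 < l \<and> (\<forall>x\<in>U. \<forall>v. l * (norm v)\<^sup>2 \<le> G x v v)"
    by (rule bilinear_posdef_coercive_near) (use assms(1,2) bil pos G in auto)
  then obtain U l where U: "open U" "x0 \<in> U" "U \<subseteq> X" "0 < l" and
    low: "\<forall>x\<in>U. \<forall>v. l * (norm v)\<^sup>2 \<le> G x v v"
    by blast
  have "\<exists>V L. open V \<and> x0 \<in> V \<and> 0 \<le> L \<and> (\<forall>i\<in>Basis \<times> Basis.
      L-lipschitz_on V (\<lambda>x. G x (fst i) (snd i)) \<and> (\<forall>y\<in>V. norm (G y (fst i) (snd i)) \<le> L))"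
    by (rule finite_lipschitz_near) (use G in auto)
  then obtain V L where V: "open V" "x0 \<in> V" "0 \<le> L" and
    VL: "\<forall>i\<in>Basis \<times> Basis. L-lipschitz_on V (\<lambda>x. G x (fst i) (snd i))"
    by blast
  have "\<exists>W M. open W \<and> x0 \<in> W \<and> 0 \<le> M \<and> (\<forall>b\<in>Basis.
      M-lipschitz_on W (\<lambda>x. K x b) \<and> (\<forall>y\<in>W. norm (K y b) \<le> M))"
    by (rule finite_lipschitz_near) (use K in auto)
  then obtain W M where W: "open W" "x0 \<in> W" "0 \<le> M" and
    WM: "\<forall>b\<in>Basis. M-lipschitz_on W (\<lambda>x. K x b)" "\<forall>b\<in>Basis. \<forall>x\<in>W. \<bar>K x b\<bar> \<le> M"
    unfolding real_norm_def by blast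
  define n where "n = real DIM('e)"
  \<comment> \<open>Divides a quadratic estimate by the norm, which may be zero.\<close>
  have cancel: "a \<le> c / l" if "l * a\<^sup>2 \<le> a * c" "0 \<le> a" "0 \<le> c" for a c
  proof (cases "a = 0")
    case False
    with that have "l * a \<le> c" by (simp add: power2_eq_square mult.left_commute)
    then show ?thesis using U by (simp add: field_simps)
  qed (use that U in auto)
  have bound: "norm (z x) \<le> n * M / l" if "x \<in> U \<inter> W" for x
  proof (rule cancel)
    have "l * (norm (z x))\<^sup>2 \<le> K x (z x)" using bspec[OF low, of x] z[of x "z x"] that U(3) by (metis IntD1 subsetD)
    also have "\<dots> \<le> norm (z x) * (\<Sum>b\<in>Basis. \<bar>K x b\<bar>)"
      using linear_norm_le_sum_Basis[OF lin, of x "z x"] that U by auto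
    also have "\<dots> \<le> norm (z x) * (n * M)"
      unfolding n_def using WM that by (intro mult_left_mono sum_bounded_above) auto
    finally show "l * (norm (z x))\<^sup>2 \<le> norm (z x) * (n * M)" .
  qed (auto simp: n_def W)
  define B where "B = n * M + n * M / l * (n * (n * L))"
  have B: "0 \<le> B" unfolding B_def n_def using U V W by auto
  show ?thesis
  proof (rule lipschitz_nearI[of "U \<inter> V \<inter> W" x0 "B / l"], goal_cases)
    case 3
    show ?case
    proof (rule lipschitz_onI)
      fix x y assume xy: "x \<in> U \<inter> V \<inter> W" "y \<in> U \<inter> V \<inter> W"
      then have X: "x \<in> X" "y \<in> X" using U by auto
      let ?d = "z x - z y" and ?D = "dist x y"
      have "norm ?d \<le> ?D * B / l"
      proof (rule cancel)
        have "l * (norm ?d)\<^sup>2 \<le> G x ?d ?d" using low xy by blast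
        also have "G x ?d ?d = K x ?d - G x (z y) ?d"
          using z X by (simp add: bilinear_lsub[OF bil])
        also have "\<dots> = (K x ?d - K y ?d) + (G y (z y) ?d - G x (z y) ?d)"
          using z X by simp
        also have "K x ?d - K y ?d \<le> norm ?d * (\<Sum>b\<in>Basis. \<bar>K x b - K y b\<bar>)"
          using linear_norm_le_sum_Basis[OF linear_compose_sub[OF lin lin], of x y ?d] X by auto
        also have "\<dots> \<le> norm ?d * (n * (M * ?D))"
          unfolding n_def
        proof (intro mult_left_mono sum_bounded_above)
          fix b :: 'e assume "b \<in> Basis"
          then show "\<bar>K x b - K y b\<bar> \<le> M * ?D"
            using lipschitz_onD[OF bspec[OF WM(1)], of b x y] xy by (auto simp: dist_norm)
        qed auto
        also have "G y (z y) ?d - G x (z y) ?d \<le>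
            norm (z y) * norm ?d * (\<Sum>b\<in>Basis. \<Sum>b'\<in>Basis. \<bar>G y b b' - G x b b'\<bar>)"
        proof -
          have "bilinear (\<lambda>u v. G y u v - G x u v)"
            using bil[of x] bil[of y] X unfolding bilinear_def by (auto intro: linear_compose_sub)
          from bilinear_norm_le_sum_Basis[OF this, of "z y" ?d] show ?thesis by linarith
        qed
        also have "\<dots> \<le> (n * M / l) * norm ?d * (n * (n * (L * ?D)))"
        proof (intro mult_mono)
          show "norm (z y) \<le> n * M / l" using bound xy by auto
          have "(\<Sum>b'\<in>Basis. \<bar>G y b b' - G x b b'\<bar>) \<le> n * (L * ?D)" if b: "b \<in> Basis" for b
            unfolding n_def
          proof (intro sum_bounded_above)
            fix b' :: 'e assume "b' \<in> Basis"
            then show "\<bar>G y b b' - G x b b'\<bar> \<le> L * ?D"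
              using lipschitz_onD[OF bspec[OF VL, of "(b, b')"], of y x] b xy
              by (auto simp: dist_norm norm_minus_commute dist_commute)
          qed
          then show "(\<Sum>b\<in>Basis. \<Sum>b'\<in>Basis. \<bar>G y b b' - G x b b'\<bar>) \<le> n * (n * (L * ?D))"
            by (subst n_def) (intro sum_bounded_above, auto)
        qed (use U W in \<open>auto simp: n_def intro!: sum_nonneg\<close>)
        finally show "l * (norm ?d)\<^sup>2 \<le> norm ?d * (?D * B)"
          unfolding B_def by (simp add: algebra_simps)
      qed (use B in auto)
      then show "dist (z x) (z y) \<le> (B / l) * ?D"
        by (simp add: dist_norm mult.commute)
    qed (use B U in auto)
  qed (use U V W in auto)
qed

section \<open>Uniqueness for autonomous differential equations\<close>

text \<open>Gronwall argument: the squared distance \<open>E\<close> of the two solutions satisfies \<open>\<bar>E'\<bar> \<le> 2 L E\<close> as long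
  as both stay in the neighbourhood on which \<open>F\<close> is Lipschitz. Hence \<open>E\<close> times a decaying
  exponential is nonincreasing to the right of \<open>t0\<close>, and \<open>E\<close> times a growing exponential is
  nondecreasing to the left of it. Since \<open>E\<close> vanishes at \<open>t0\<close>, it vanishes on both sides.\<close>

lemma ode_local_uniqueness:
  fixes z1 z2 :: "real \<Rightarrow> 'e::real_inner"
  assumes "open T" "t0 \<in> T"
    and d1: "\<And>t. t \<in> T \<Longrightarrow> (z1 has_vector_derivative F (z1 t)) (at t)"
    and d2: "\<And>t. t \<in> T \<Longrightarrow> (z2 has_vector_derivative F (z2 t)) (at t)"
    and eq: "z1 t0 = z2 t0" and lip: "lipschitz_near F (z1 t0)"
  obtains e where "0 < e" "\<And>t. dist t t0 < e \<Longrightarrow> z1 t = z2 t"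
proof -
  obtain U L where U: "open U" "z1 t0 \<in> U" "L-lipschitz_on U F"
    using lip unfolding lipschitz_near_def by blast
  have "isCont z1 t0" "isCont z2 t0"
    using d1 d2 assms(2) has_vector_derivative_continuous by blast+
  then have "(z1 \<longlongrightarrow> z1 t0) (nhds t0)" "(z2 \<longlongrightarrow> z2 t0) (nhds t0)"
    by (simp_all only: isCont_def tendsto_at_iff_tendsto_nhds)
  then have "\<forall>\<^sub>F t in nhds t0. z1 t \<in> U" "\<forall>\<^sub>F t in nhds t0. z2 t \<in> U"
    using U(1,2) eq by (auto dest: topological_tendstoD)
  then have "\<forall>\<^sub>F t in nhds t0. t \<in> T \<and> z1 t \<in> U \<and> z2 t \<in> U"
    using eventually_nhds_in_open[OF assms(1,2)] by (simp add: eventually_conj)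
  then obtain e where e: "0 < e" "\<And>t. dist t t0 < e \<Longrightarrow> t \<in> T \<and> z1 t \<in> U \<and> z2 t \<in> U"
    unfolding eventually_nhds_metric by blast
  define E where "E t = (z1 t - z2 t) \<bullet> (z1 t - z2 t)" for t
  define E' where "E' t = 2 * ((z1 t - z2 t) \<bullet> (F (z1 t) - F (z2 t)))" for t
  have dE: "(E has_real_derivative E' t) (at t)" if "dist t t0 < e" for t
  proof -
    have "((\<lambda>t. z1 t - z2 t) has_vector_derivative F (z1 t) - F (z2 t)) (at t)"
      using d1 d2 e(2)[OF that] by (intro has_vector_derivative_diff) auto
    then have D: "((\<lambda>t. z1 t - z2 t) has_derivative (\<lambda>h. h *\<^sub>R (F (z1 t) - F (z2 t)))) (at t)"
      by (simp add: has_vector_derivative_def)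
    show ?thesis
      unfolding E_def E'_def has_field_derivative_def
      by (rule has_derivative_eq_rhs[OF has_derivative_inner[OF D D]])
        (auto simp: inner_commute algebra_simps)
  qed
  have bd: "\<bar>E' t\<bar> \<le> 2 * L * E t" if "dist t t0 < e" for t
  proof -
    have "\<bar>E' t\<bar> \<le> 2 * (norm (z1 t - z2 t) * norm (F (z1 t) - F (z2 t)))"
      unfolding E'_def using Cauchy_Schwarz_ineq2[of "z1 t - z2 t" "F (z1 t) - F (z2 t)"]
      by (simp add: abs_mult)
    also have "\<dots> \<le> 2 * (norm (z1 t - z2 t) * (L * norm (z1 t - z2 t)))"
      using lipschitz_onD[OF U(3), of "z1 t" "z2 t"] e(2)[OF that]
      by (intro mult_left_mono) (auto simp: dist_norm)
    finally show ?thesis unfolding E_def by (simp add: dot_square_norm power2_eq_square mult_ac)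
  qed
  have E0: "E t0 = 0" unfolding E_def using eq by simp
  have E_le: "E t \<le> 0" if t: "dist t t0 < e" for t
  proof (cases "t0 \<le> t")
    case True
    have "(\<lambda>s. E s * exp (- 2 * L * s)) t \<le> (\<lambda>s. E s * exp (- 2 * L * s)) t0"
    proof (rule DERIV_nonpos_imp_nonincreasing[OF True])
      fix s assume "t0 \<le> s" "s \<le> t"
      then have s: "dist s t0 < e" using t by (auto simp: dist_norm)
      have "((\<lambda>s. E s * exp (- 2 * L * s)) has_real_derivative
          (E' s - 2 * L * E s) * exp (- 2 * L * s)) (at s)"
        by (rule derivative_eq_intros dE s refl)+ (simp add: algebra_simps)
      moreover have "(E' s - 2 * L * E s) * exp (- 2 * L * s) \<le> 0"
        using bd[OF s] by (intro mult_nonpos_nonneg) auto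
      ultimately show "\<exists>y. ((\<lambda>s. E s * exp (- 2 * L * s)) has_real_derivative y) (at s) \<and> y \<le> 0"
        by blast
    qed
    then show ?thesis using E0 by (simp add: mult_le_0_iff)
  next
    case False
    then have "t \<le> t0" by simp
    have "(\<lambda>s. E s * exp (2 * L * s)) t \<le> (\<lambda>s. E s * exp (2 * L * s)) t0"
    proof (rule DERIV_nonneg_imp_nondecreasing[OF \<open>t \<le> t0\<close>])
      fix s assume "t \<le> s" "s \<le> t0"
      then have s: "dist s t0 < e" using t by (auto simp: dist_norm)
      have "((\<lambda>s. E s * exp (2 * L * s)) has_real_derivative
          (E' s + 2 * L * E s) * exp (2 * L * s)) (at s)"
        by (rule derivative_eq_intros dE s refl)+ (simp add: algebra_simps)
      moreover have "0 \<le> (E' s + 2 * L * E s) * exp (2 * L * s)"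
        using bd[OF s] by (intro mult_nonneg_nonneg) auto
      ultimately show "\<exists>y. ((\<lambda>s. E s * exp (2 * L * s)) has_real_derivative y) (at s) \<and> 0 \<le> y"
        by blast
    qed
    then show ?thesis using E0 by (simp add: mult_le_0_iff)
  qed
  have "z1 t = z2 t" if "dist t t0 < e" for t
    using E_le[OF that] inner_gt_zero_iff[of "z1 t - z2 t"] unfolding E_def by (simp add: not_less[symmetric])
  with e(1) show ?thesis using that by blast
qed

section \<open>Charts and tangent vectors\<close>

locale smooth_manifold =
  fixes A :: "('a::topological_space, 'e::euclidean_space) chart set"
  assumes atlas: "smooth_atlas A"
begin

lemma chart_homeomorphism:
  assumes "\<phi> \<in> A"
  shows "open (fst \<phi>)" "open (snd \<phi> ` fst \<phi>)"
    and "homeomorphism (fst \<phi>) (snd \<phi> ` fst \<phi>) (snd \<phi>) (chart_inv \<phi>)"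
  using atlas assms unfolding smooth_atlas_def is_chart_def by auto

lemma chart_inv_chart: "\<phi> \<in> A \<Longrightarrow> p \<in> fst \<phi> \<Longrightarrow> chart_inv \<phi> (snd \<phi> p) = p"
  using chart_homeomorphism(3) by (auto simp: homeomorphism_def)

lemma chart_chart_inv:
  assumes "\<phi> \<in> A" "y \<in> snd \<phi> ` fst \<phi>"
  shows "snd \<phi> (chart_inv \<phi> y) = y" "chart_inv \<phi> y \<in> fst \<phi>"
  using chart_inv_chart[OF assms(1)] assms(2) by auto

lemma open_chart_image:
  assumes "\<phi> \<in> A" "open U"
  shows "open (snd \<phi> ` (fst \<phi> \<inter> U))"
proof -
  have "snd \<phi> ` (fst \<phi> \<inter> U) = snd \<phi> ` fst \<phi> \<inter> chart_inv \<phi> -` U"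
    using chart_inv_chart[OF assms(1)] by force
  then show ?thesis
    using continuous_open_preimage[OF _ chart_homeomorphism(2)[OF assms(1)] assms(2), of "chart_inv \<phi>"]
      chart_homeomorphism(3)[OF assms(1)] by (simp add: homeomorphism_def)
qed

lemma chart_at: "chart_at A p \<in> A" "p \<in> fst (chart_at A p)"
proof -
  have "\<exists>\<phi>. \<phi> \<in> A \<and> p \<in> fst \<phi>" using atlas unfolding smooth_atlas_def by blast
  then show "chart_at A p \<in> A" "p \<in> fst (chart_at A p)"
    unfolding chart_at_def by (metis (mono_tags, lifting) someI_ex)+
qed

lemma transition_has_derivative:
  assumes "\<phi> \<in> A" "\<psi> \<in> A" "p \<in> fst \<phi>" "p \<in> fst \<psi>"
  shows "(snd \<psi> \<circ> chart_inv \<phi> has_derivative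
    frechet_derivative (snd \<psi> \<circ> chart_inv \<phi>) (at (snd \<phi> p))) (at (snd \<phi> p))"
  using atlas assms unfolding smooth_atlas_def by (intro smooth_on_has_derivative) auto

lemma tangent_of_coord_linear:
  assumes "\<phi> \<in> A" "p \<in> fst \<phi>"
  shows "linear (tangent_of_coord A \<phi> p)"
  unfolding tangent_of_coord_def
  using has_derivative_linear[OF transition_has_derivative] assms chart_at by blast

text \<open>The transition map from the selected chart back to the given one is a left inverse near the
  point, so its derivative is a left inverse by the chain rule.\<close>

lemma tangent_of_coord_inj:
  assumes "\<phi> \<in> A" "p \<in> fst \<phi>"
  shows "inj (tangent_of_coord A \<phi> p)"
proof -
  let ?\<psi> = "chart_at A p"
  let ?S = "snd \<phi> ` (fst \<phi> \<inter> fst ?\<psi>)"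
  note \<psi> = chart_at[of p]
  let ?B = "frechet_derivative (snd \<phi> \<circ> chart_inv ?\<psi>) (at (snd ?\<psi> p))"
  have "(snd \<phi> \<circ> chart_inv ?\<psi> has_derivative ?B) (at ((snd ?\<psi> \<circ> chart_inv \<phi>) (snd \<phi> p)))"
    using transition_has_derivative[OF \<psi>(1) assms(1) \<psi>(2) assms(2)] chart_inv_chart[OF assms] by simp
  from diff_chain_at[OF transition_has_derivative[OF assms(1) \<psi>(1) assms(2) \<psi>(2)] this]
  have "((snd \<phi> \<circ> chart_inv ?\<psi>) \<circ> (snd ?\<psi> \<circ> chart_inv \<phi>) has_derivative
      ?B \<circ> tangent_of_coord A \<phi> p) (at (snd \<phi> p))"
    unfolding tangent_of_coord_def[abs_def] .
  then have "(id has_derivative ?B \<circ> tangent_of_coord A \<phi> p) (at (snd \<phi> p))"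
  proof (rule has_derivative_transform_within_open)
    show "open ?S"
      using open_chart_image[OF assms(1)] chart_homeomorphism(1)[OF \<psi>(1)] by blast
    show "snd \<phi> p \<in> ?S" using assms \<psi> by blast
  qed (use chart_inv_chart[OF assms(1)] chart_inv_chart[OF \<psi>(1)] in auto)
  then have "?B \<circ> tangent_of_coord A \<phi> p = id"
    using has_derivative_id has_derivative_unique by blast
  then show ?thesis by (metis inj_on_id inj_on_imageI2)
qed

lemma curve_in_chart:
  assumes "open J" "smooth_curve_on A c J" "\<phi> \<in> A"
  shows "open {t\<in>J. c t \<in> fst \<phi>}" "smooth_on (snd \<phi> \<circ> c) {t\<in>J. c t \<in> fst \<phi>}"
proof -
  have "{t\<in>J. c t \<in> fst \<phi>} = J \<inter> c -` fst \<phi>" by auto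
  then show "open {t\<in>J. c t \<in> fst \<phi>}"
    using assms continuous_open_preimage[OF _ assms(1) chart_homeomorphism(1)[OF assms(3)]]
    by (simp add: smooth_curve_on_def)
  show "smooth_on (snd \<phi> \<circ> c) {t\<in>J. c t \<in> fst \<phi>}"
    using assms by (simp add: smooth_curve_on_def)
qed

text \<open>The velocity is defined by the chart selected at the current point, which may change along the curve.
  This lemma expresses it, near any given time, in one fixed chart.\<close>

lemma velocity_eq_tangent_of_coord:
  assumes "open J" "smooth_curve_on A c J" "\<phi> \<in> A" "t \<in> J" "c t \<in> fst \<phi>"
  shows "velocity A c t = tangent_of_coord A \<phi> (c t) (vector_derivative (snd \<phi> \<circ> c) (at t))"
proof -
  let ?\<psi> = "chart_at A (c t)" and ?y = "vector_derivative (snd \<phi> \<circ> c) (at t)"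
  note lin = tangent_of_coord_linear[OF assms(3,5)]
  have "(snd \<phi> \<circ> c has_vector_derivative ?y) (at t)"
    using smooth_curve_derivatives(1)[OF curve_in_chart[OF assms(1-3)]] assms by blast
  then have 1: "(snd \<phi> \<circ> c has_derivative (\<lambda>h. h *\<^sub>R ?y)) (at t)"
    by (simp add: has_vector_derivative_def)
  have 2: "(snd ?\<psi> \<circ> chart_inv \<phi> has_derivative tangent_of_coord A \<phi> (c t)) (at ((snd \<phi> \<circ> c) t))"
    using transition_has_derivative[OF assms(3) chart_at(1) assms(5) chart_at(2)]
    by (simp add: tangent_of_coord_def[abs_def])
  have "((snd ?\<psi> \<circ> chart_inv \<phi>) \<circ> (snd \<phi> \<circ> c) has_derivative
      tangent_of_coord A \<phi> (c t) \<circ> (\<lambda>h. h *\<^sub>R ?y)) (at t)"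
    by (rule diff_chain_at[OF 1 2])
  then have "(snd ?\<psi> \<circ> c has_derivative tangent_of_coord A \<phi> (c t) \<circ> (\<lambda>h. h *\<^sub>R ?y)) (at t)"
    by (rule has_derivative_transform_within_open[OF _ curve_in_chart(1)[OF assms(1-3)]])
      (use assms chart_inv_chart[OF assms(3)] in auto)
  then have "(snd ?\<psi> \<circ> c has_vector_derivative tangent_of_coord A \<phi> (c t) ?y) (at t)"
    by (simp add: has_vector_derivative_def linear_cmul[OF lin] comp_def)
  then show ?thesis unfolding velocity_def by (rule vector_derivative_at)
qed

end

section \<open>The metric and the Christoffel symbols in a chart\<close>

text \<open>The right-hand side of the Koszul formula, which determines the Christoffel symbol by its inner
  products.\<close>

definition koszul ::
  "('a, 'e::euclidean_space) chart set \<Rightarrow> ('a \<Rightarrow> 'e \<Rightarrow> 'e \<Rightarrow> real) \<Rightarrow> ('a, 'e) chart \<Rightarrow>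
   'e \<Rightarrow> 'e \<Rightarrow> 'e \<Rightarrow> 'e \<Rightarrow> real" where
  "koszul A g \<phi> y u v w =
     (metric_deriv A g \<phi> y u v w + metric_deriv A g \<phi> y v u w - metric_deriv A g \<phi> y w u v) / 2"

locale riemannian_manifold = smooth_manifold A
  for A :: "('a::t2_space, 'e::euclidean_space) chart set" +
  fixes g :: "'a \<Rightarrow> 'e \<Rightarrow> 'e \<Rightarrow> real"
  assumes metric: "riemannian_metric A g"
begin

lemma metric_bilinear: "bilinear (g p)"
  and metric_pos: "v \<noteq> 0 \<Longrightarrow> 0 < g p v v"
  using metric unfolding riemannian_metric_def by blast+

lemma metric_coord_bilinear:
  assumes "\<phi> \<in> A" "y \<in> snd \<phi> ` fst \<phi>"
  shows "bilinear (metric_coord A g \<phi> y)"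
proof -
  let ?p = "chart_inv \<phi> y"
  have T: "linear (tangent_of_coord A \<phi> ?p)"
    using tangent_of_coord_linear chart_chart_inv assms by blast
  have "linear (g ?p u)" "linear (\<lambda>u. g ?p u v)" for u v
    using metric_bilinear[of ?p] by (auto simp: bilinear_def)
  then show ?thesis
    using linear_compose[OF T] unfolding bilinear_def metric_coord_def comp_def by blast
qed

lemma metric_coord_pos:
  assumes "\<phi> \<in> A" "y \<in> snd \<phi> ` fst \<phi>" "v \<noteq> 0"
  shows "0 < metric_coord A g \<phi> y v v"
proof -
  have "chart_inv \<phi> y \<in> fst \<phi>" using chart_chart_inv assms by blast
  then have "tangent_of_coord A \<phi> (chart_inv \<phi> y) v \<noteq> 0"
    using tangent_of_coord_inj[OF assms(1)] linear_0[OF tangent_of_coord_linear[OF assms(1)]] assms(3)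
    by (metis injD)
  then show ?thesis unfolding metric_coord_def by (rule metric_pos)
qed

lemma metric_coord_smooth:
  "\<phi> \<in> A \<Longrightarrow> smooth_on (\<lambda>y. metric_coord A g \<phi> y u v) (snd \<phi> ` fst \<phi>)"
  using metric unfolding riemannian_metric_def by blast

lemma metric_coord_has_derivative:
  assumes "\<phi> \<in> A" "y \<in> snd \<phi> ` fst \<phi>"
  shows "((\<lambda>y. metric_coord A g \<phi> y u v) has_derivative (\<lambda>w. metric_deriv A g \<phi> y w u v)) (at y)"
  unfolding metric_deriv_def
  using smooth_on_has_derivative[OF metric_coord_smooth[OF assms(1)] assms(2)] by simp

lemma metric_deriv_linear:
  assumes "\<phi> \<in> A" "y \<in> snd \<phi> ` fst \<phi>"
  shows "linear (\<lambda>w. metric_deriv A g \<phi> y w u v)"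
  using has_derivative_linear[OF metric_coord_has_derivative[OF assms]] .

text \<open>Bilinearity of the coordinate metric holds only at points of the chart image. That image is open,
  so the identities hold on a neighbourhood and can be differentiated there.\<close>

lemma metric_deriv_bilinear:
  assumes "\<phi> \<in> A" "y \<in> snd \<phi> ` fst \<phi>"
  shows "bilinear (metric_deriv A g \<phi> y w)"
proof -
  note d = metric_coord_has_derivative[OF assms]
  note open_im = chart_homeomorphism(2)[OF assms(1)]
  note B = metric_coord_bilinear[OF assms(1)]
  have eq: "metric_deriv A g \<phi> y w u v = D w"
    if "(f has_derivative D) (at y)" "\<And>z. z \<in> snd \<phi> ` fst \<phi> \<Longrightarrow> f z = metric_coord A g \<phi> z u v"
    for f D u v
  proof -
    have "((\<lambda>z. metric_coord A g \<phi> z u v) has_derivative D) (at y)"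
      using has_derivative_transform_within_open[OF that(1) open_im assms(2) that(2)] .
    then show ?thesis using has_derivative_unique[OF d] by metis
  qed
  show ?thesis
    unfolding bilinear_def
  proof (intro conjI allI linearI)
    fix u v v' and r :: real
    show "metric_deriv A g \<phi> y w u (v + v') = metric_deriv A g \<phi> y w u v + metric_deriv A g \<phi> y w u v'"
      by (rule eq[OF has_derivative_add[OF d d]]) (simp add: bilinear_radd[OF B])
    show "metric_deriv A g \<phi> y w (v + v') u = metric_deriv A g \<phi> y w v u + metric_deriv A g \<phi> y w v' u"
      by (rule eq[OF has_derivative_add[OF d d]]) (simp add: bilinear_ladd[OF B])
    show "metric_deriv A g \<phi> y w u (r *\<^sub>R v) = r *\<^sub>R metric_deriv A g \<phi> y w u v"
      by (rule eq[OF has_derivative_scaleR_right[OF d]]) (simp add: bilinear_rmul[OF B])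
    show "metric_deriv A g \<phi> y w (r *\<^sub>R v) u = r *\<^sub>R metric_deriv A g \<phi> y w v u"
      by (rule eq[OF has_derivative_scaleR_right[OF d]]) (simp add: bilinear_lmul[OF B])
  qed
qed

lemma koszul_linear:
  assumes "\<phi> \<in> A" "y \<in> snd \<phi> ` fst \<phi>"
  shows "linear (koszul A g \<phi> y u v)"
  using metric_deriv_linear[OF assms] metric_deriv_bilinear[OF assms]
  unfolding koszul_def[abs_def] bilinear_def
  by (auto simp: linear_iff algebra_simps add_divide_distrib diff_divide_distrib)

lemma koszul_bilinear:
  assumes "\<phi> \<in> A" "y \<in> snd \<phi> ` fst \<phi>"
  shows "bilinear (\<lambda>u v. koszul A g \<phi> y u v w)"
  using metric_deriv_linear[OF assms] metric_deriv_bilinear[OF assms]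
  unfolding koszul_def[abs_def] bilinear_def
  by (auto simp: linear_iff algebra_simps add_divide_distrib diff_divide_distrib)

lemma koszul_lipschitz_near:
  assumes "\<phi> \<in> A" "y \<in> snd \<phi> ` fst \<phi>"
  shows "lipschitz_near (\<lambda>y. koszul A g \<phi> y u v w) y"
proof -
  have M: "lipschitz_near (\<lambda>y. metric_deriv A g \<phi> y a b c) y" for a b c
    unfolding metric_deriv_def
    using chart_homeomorphism(2) assms
    by (intro smooth_imp_lipschitz_near[OF _ smooth_on_frechet_derivative[OF metric_coord_smooth]]) auto
  have "lipschitz_near (\<lambda>y. (metric_deriv A g \<phi> y u v w + metric_deriv A g \<phi> y v u w) * (1 / 2)
      + metric_deriv A g \<phi> y w u v * (- 1 / 2)) y"
    by (intro lipschitz_near_add lipschitz_near_mult M lipschitz_near_const)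
  moreover have "koszul A g \<phi> y u v w = (metric_deriv A g \<phi> y u v w + metric_deriv A g \<phi> y v u w) * (1 / 2)
      + metric_deriv A g \<phi> y w u v * (- 1 / 2)" for y
    unfolding koszul_def by (simp add: field_simps)
  ultimately show ?thesis by simp
qed

lemma christoffel_unique:
  assumes "\<phi> \<in> A" "y \<in> snd \<phi> ` fst \<phi>"
  shows "\<exists>!z. \<forall>w. metric_coord A g \<phi> y z w = koszul A g \<phi> y u v w"
  by (rule posdef_riesz) (use metric_coord_bilinear metric_coord_pos koszul_linear assms in auto)

lemma christoffel_eqI:
  assumes "\<phi> \<in> A" "y \<in> snd \<phi> ` fst \<phi>" "\<And>w. metric_coord A g \<phi> y z w = koszul A g \<phi> y u v w"
  shows "christoffel A g \<phi> y u v = z"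
  using the1_equality[OF christoffel_unique[OF assms(1,2)]] assms(3)
  unfolding christoffel_def koszul_def by blast

lemma metric_christoffel:
  assumes "\<phi> \<in> A" "y \<in> snd \<phi> ` fst \<phi>"
  shows "metric_coord A g \<phi> y (christoffel A g \<phi> y u v) w = koszul A g \<phi> y u v w"
  using christoffel_unique[OF assms, of u v] christoffel_eqI[OF assms] by metis

text \<open>This homogeneity is why an affine reparametrization of a geodesic is again a geodesic.\<close>

lemma christoffel_scaleR:
  assumes "\<phi> \<in> A" "y \<in> snd \<phi> ` fst \<phi>"
  shows "christoffel A g \<phi> y (r *\<^sub>R u) (r *\<^sub>R v) = (r * r) *\<^sub>R christoffel A g \<phi> y u v"
  by (rule christoffel_eqI[OF assms])
    (simp add: metric_christoffel[OF assms] bilinear_lmul[OF metric_coord_bilinear[OF assms]]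
      bilinear_lmul[OF koszul_bilinear[OF assms]] bilinear_rmul[OF koszul_bilinear[OF assms]])

text \<open>The geodesic equation in a chart, as a first-order equation for position and velocity.\<close>

definition geodesic_spray :: "('a, 'e) chart \<Rightarrow> 'e \<times> 'e \<Rightarrow> 'e \<times> 'e" where
  "geodesic_spray \<phi> z = (snd z, - christoffel A g \<phi> (fst z) (snd z) (snd z))"

text \<open>The negated Christoffel symbol, as a function of position and velocity, solves a linear system whose
  matrix is the metric and whose right-hand side is quadratic in the velocity with smooth
  coefficients depending on the position.\<close>

lemma geodesic_spray_lipschitz_near:
  assumes "\<phi> \<in> A" "fst z \<in> snd \<phi> ` fst \<phi>"
  shows "lipschitz_near (geodesic_spray \<phi>) z"
proof -
  let ?X = "(snd \<phi> ` fst \<phi>) \<times> (UNIV :: 'e set)"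
  have X: "open ?X" "z \<in> ?X"
    using chart_homeomorphism(2)[OF assms(1)] assms(2) by (auto intro: open_Times simp: mem_Times_iff)
  have fst1: "1-lipschitz_on UNIV (fst :: 'e \<times> 'e \<Rightarrow> 'e)"
    by (rule lipschitz_onI) (auto simp: dist_fst_le)
  have "lipschitz_near (\<lambda>z. - christoffel A g \<phi> (fst z) (snd z) (snd z)) z"
  proof (rule lipschitz_near_implicit_linear[OF X, where
        G = "\<lambda>z. metric_coord A g \<phi> (fst z)" and K = "\<lambda>z w. - koszul A g \<phi> (fst z) (snd z) (snd z) w"])
    fix b b' :: 'e
    show "lipschitz_near (\<lambda>z. metric_coord A g \<phi> (fst z) b b') z"
      using smooth_imp_lipschitz_near[OF chart_homeomorphism(2) metric_coord_smooth] assms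
      by (intro lipschitz_near_compose_lipschitz[OF _ fst1, where f = "\<lambda>y. metric_coord A g \<phi> y b b'"]) auto
    have *: "lipschitz_near (\<lambda>z::'e\<times>'e. snd z \<bullet> i) z" for i
      by (intro lipschitz_near_bounded_linear bounded_linear_compose[OF bounded_linear_inner_left bounded_linear_snd])
    have "lipschitz_near (\<lambda>z. \<Sum>i\<in>Basis. \<Sum>j\<in>Basis.
        ((snd z \<bullet> i) * (snd z \<bullet> j) * koszul A g \<phi> (fst z) i j b) * (-1)) z"
      using koszul_lipschitz_near[OF assms]
      by (intro lipschitz_near_sum lipschitz_near_mult lipschitz_near_const *
          lipschitz_near_compose_lipschitz[OF _ fst1, where f = "\<lambda>y. koszul A g \<phi> y i j b" for i j])
    then show "lipschitz_near (\<lambda>z. - koszul A g \<phi> (fst z) (snd z) (snd z) b) z"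
    proof (rule lipschitz_near_cong[OF _ X])
      fix p assume "p \<in> ?X"
      then have "fst p \<in> snd \<phi> ` fst \<phi>" by auto
      from bilinear_expand_Basis[OF koszul_bilinear[OF assms(1) this], of "snd p" "snd p" b]
      show "(\<Sum>i\<in>Basis. \<Sum>j\<in>Basis. ((snd p \<bullet> i) * (snd p \<bullet> j) * koszul A g \<phi> (fst p) i j b) * (-1))
          = - koszul A g \<phi> (fst p) (snd p) (snd p) b"
        by (simp add: sum_negf)
    qed
  next
    fix p w assume "p \<in> ?X"
    then have p: "fst p \<in> snd \<phi> ` fst \<phi>" by auto
    show "bilinear (metric_coord A g \<phi> (fst p))" using metric_coord_bilinear assms p by blast
    show "linear (\<lambda>w. - koszul A g \<phi> (fst p) (snd p) (snd p) w)"
      using koszul_linear[OF assms(1) p] by (rule linear_compose_neg)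
    show "metric_coord A g \<phi> (fst p) (- christoffel A g \<phi> (fst p) (snd p) (snd p)) w =
        - koszul A g \<phi> (fst p) (snd p) (snd p) w"
      by (simp add: bilinear_lneg[OF metric_coord_bilinear[OF assms(1) p]] metric_christoffel[OF assms(1) p])
  next
    fix v :: 'e assume "v \<noteq> 0"
    then show "0 < metric_coord A g \<phi> (fst z) v v" using metric_coord_pos assms by blast
  qed
  then show ?thesis
    unfolding geodesic_spray_def[abs_def]
    by (intro lipschitz_near_Pair) (auto intro: lipschitz_near_bounded_linear bounded_linear_snd)
qed

end

section \<open>Geodesics\<close>

context smooth_manifold
begin

lemma velocity_cong:
  assumes "open U" "t \<in> U" "\<And>s. s \<in> U \<Longrightarrow> c s = c' s"
  shows "velocity A c t = velocity A c' t"
proof -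
  have "\<forall>\<^sub>F s in nhds t. c s = c' s"
    using eventually_nhds_in_open[OF assms(1,2)] assms(3) by (rule eventually_mono)
  then have "\<forall>\<^sub>F s in nhds t. s \<in> UNIV \<longrightarrow>
      (snd (chart_at A (c' t)) \<circ> c) s = (snd (chart_at A (c' t)) \<circ> c') s"
    by (auto elim: eventually_mono)
  then show ?thesis
    unfolding velocity_def using assms(2,3) by (subst vector_derivative_cong_eq) auto
qed

lemma smooth_curve_affine_reparam:
  assumes "smooth_curve_on A c UNIV"
  shows "smooth_curve_on A (\<lambda>s. c (a + s * b)) UNIV"
  unfolding smooth_curve_on_def
proof (intro conjI ballI)
  have "continuous_on UNIV c" using assms unfolding smooth_curve_on_def by blast
  then show "continuous_on UNIV (\<lambda>s. c (a + s * b))"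
    by (rule continuous_on_compose2) (auto intro!: continuous_intros)
  fix \<phi> assume "\<phi> \<in> A"
  note S = curve_in_chart[OF open_UNIV assms this]
  show "smooth_on (snd \<phi> \<circ> (\<lambda>s. c (a + s * b))) {t \<in> UNIV. c (a + t * b) \<in> fst \<phi>}"
    using smooth_on_affine_reparam[OF S, of a b] by (simp add: comp_def)
qed

lemma velocity_affine_reparam:
  assumes "smooth_curve_on A c UNIV"
  shows "velocity A (\<lambda>s. c (a + s * b)) s = b *\<^sub>R velocity A c (a + s * b)"
proof -
  let ?p = "c (a + s * b)"
  let ?\<phi> = "chart_at A ?p"
  note \<phi> = chart_at[of ?p]
  note d = smooth_curve_derivatives(1)[OF curve_in_chart[OF open_UNIV assms \<phi>(1)], of "a + s * b"]
  have "(snd ?\<phi> \<circ> c has_vector_derivative velocity A c (a + s * b)) (at (a + s * b))"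
    unfolding velocity_def using d \<phi>(2) by simp
  from has_vector_derivative_affine_reparam[OF this] show ?thesis
    unfolding velocity_def[of A "\<lambda>s. c (a + s * b)"]
    by (intro vector_derivative_at) (simp add: comp_def)
qed

end

context riemannian_manifold
begin

lemma geodesic_solves_spray:
  assumes "open J" "geodesic_on A g c J" "\<phi> \<in> A" "t \<in> J" "c t \<in> fst \<phi>"
  shows "((\<lambda>s. (snd \<phi> (c s), vector_derivative (snd \<phi> \<circ> c) (at s))) has_vector_derivative
    geodesic_spray \<phi> (snd \<phi> (c t), vector_derivative (snd \<phi> \<circ> c) (at t))) (at t)"
proof -
  have c: "smooth_curve_on A c J" "acceleration_coord A g \<phi> c t = 0"
    using assms unfolding geodesic_on_def by auto
  have t: "t \<in> {t\<in>J. c t \<in> fst \<phi>}" using assms by blast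
  note d = smooth_curve_derivatives[OF curve_in_chart[OF assms(1) c(1) assms(3)] t]
  show ?thesis
    using has_vector_derivative_Pair[OF d(1,2)] c(2)
    by (simp add: geodesic_spray_def acceleration_coord_def Let_def add_eq_0_iff2)
qed

lemma geodesic_affine_reparam:
  assumes "geodesic_on A g c UNIV"
  shows "geodesic_on A g (\<lambda>s. c (a + s * b)) UNIV"
  unfolding geodesic_on_def
proof (intro conjI ballI impI)
  have c: "smooth_curve_on A c UNIV" using assms unfolding geodesic_on_def by blast
  then show "smooth_curve_on A (\<lambda>s. c (a + s * b)) UNIV" by (rule smooth_curve_affine_reparam)
  fix t \<phi> assume \<phi>: "\<phi> \<in> A" "c (a + t * b) \<in> fst \<phi>"
  define y' where "y' s = vector_derivative (snd \<phi> \<circ> c) (at s)" for s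
  define y'' where "y'' s = vector_derivative y' (at s)" for s
  note d = smooth_curve_derivatives[OF curve_in_chart[OF open_UNIV c \<phi>(1)]]
  let ?S = "{s. c (a + s * b) \<in> fst \<phi>}"
  have S: "open ?S"
    using curve_in_chart(1)[OF open_UNIV smooth_curve_affine_reparam[OF c] \<phi>(1), of a b] by simp
  have d1: "vector_derivative (snd \<phi> \<circ> (\<lambda>s. c (a + s * b))) (at s) = b *\<^sub>R y' (a + s * b)"
    if "s \<in> ?S" for s
    using has_vector_derivative_affine_reparam[OF d(1), of a s b] that
    unfolding y'_def by (intro vector_derivative_at) (simp add: comp_def)
  have "(y' has_vector_derivative y'' (a + t * b)) (at (a + t * b))"
    using d(2)[of "a + t * b"] \<phi> unfolding y''_def y'_def[abs_def] by simp
  then have "((\<lambda>s. b *\<^sub>R y' (a + s * b)) has_vector_derivative b *\<^sub>R b *\<^sub>R y'' (a + t * b)) (at t)"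
    by (intro has_vector_derivative_affine_reparam bounded_linear.has_vector_derivative[OF bounded_linear_scaleR_right])
  then have "((\<lambda>s. vector_derivative (snd \<phi> \<circ> (\<lambda>s. c (a + s * b))) (at s))
      has_vector_derivative b *\<^sub>R b *\<^sub>R y'' (a + t * b)) (at t)"
    by (rule has_vector_derivative_transform_within_open[OF _ S]) (use \<phi> d1 in auto)
  then have d2: "vector_derivative (\<lambda>s. vector_derivative (snd \<phi> \<circ> (\<lambda>s. c (a + s * b))) (at s)) (at t)
      = (b * b) *\<^sub>R y'' (a + t * b)"
    by (simp add: vector_derivative_at)
  have "acceleration_coord A g \<phi> c (a + t * b) = 0"
    using assms \<phi> unfolding geodesic_on_def by blast
  then have "y'' (a + t * b) + christoffel A g \<phi> (snd \<phi> (c (a + t * b))) (y' (a + t * b)) (y' (a + t * b)) = 0"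
    by (simp add: acceleration_coord_def Let_def y''_def y'_def[abs_def])
  then show "acceleration_coord A g \<phi> (\<lambda>s. c (a + s * b)) t = 0"
    using \<phi> by (simp add: acceleration_coord_def Let_def d1 d2 christoffel_scaleR
        scaleR_add_right[symmetric] del: scaleR_add_right)
qed

text \<open>Near the common point both geodesics lie in one chart, where position and coordinate velocity
  solve the differential equation of the spray. The selected chart at the initial point is used
  because its coordinate velocities are the velocities there.\<close>

lemma geodesic_local_uniqueness:
  assumes "open J1" "open J2" "geodesic_on A g c1 J1" "geodesic_on A g c2 J2"
    and t0: "t0 \<in> J1" "t0 \<in> J2" "c1 t0 = c2 t0" "velocity A c1 t0 = velocity A c2 t0"
  shows "\<forall>\<^sub>F t in nhds t0. c1 t = c2 t \<and> velocity A c1 t = velocity A c2 t"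
proof -
  let ?\<phi> = "chart_at A (c1 t0)"
  note \<phi> = chart_at[of "c1 t0"]
  have c: "smooth_curve_on A c1 J1" "smooth_curve_on A c2 J2"
    using assms unfolding geodesic_on_def by auto
  define T where "T = {t\<in>J1. c1 t \<in> fst ?\<phi>} \<inter> {t\<in>J2. c2 t \<in> fst ?\<phi>}"
  define z1 where "z1 t = (snd ?\<phi> (c1 t), vector_derivative (snd ?\<phi> \<circ> c1) (at t))" for t
  define z2 where "z2 t = (snd ?\<phi> (c2 t), vector_derivative (snd ?\<phi> \<circ> c2) (at t))" for t
  have T: "open T" "t0 \<in> T"
    unfolding T_def using curve_in_chart(1)[OF assms(1) c(1) \<phi>(1)]
      curve_in_chart(1)[OF assms(2) c(2) \<phi>(1)] t0 \<phi>(2) by (auto intro: open_Int)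
  have "velocity A c1 t0 = snd (z1 t0)" "velocity A c2 t0 = snd (z2 t0)"
    unfolding velocity_def z1_def z2_def using t0 by auto
  then have eq: "z1 t0 = z2 t0" using t0 unfolding z1_def z2_def by simp
  have d1: "(z1 has_vector_derivative geodesic_spray ?\<phi> (z1 t)) (at t)" if "t \<in> T" for t
    unfolding z1_def by (rule geodesic_solves_spray[OF assms(1,3) \<phi>(1)]) (use that T_def in auto)
  have d2: "(z2 has_vector_derivative geodesic_spray ?\<phi> (z2 t)) (at t)" if "t \<in> T" for t
    unfolding z2_def by (rule geodesic_solves_spray[OF assms(2,4) \<phi>(1)]) (use that T_def in auto)
  have lip: "lipschitz_near (geodesic_spray ?\<phi>) (z1 t0)"
    using \<phi> by (intro geodesic_spray_lipschitz_near) (auto simp: z1_def)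
  have "\<forall>\<^sub>F t in nhds t0. z1 t = z2 t"
    by (rule ode_local_uniqueness[OF T d1 d2 eq lip]) (auto simp: eventually_nhds_metric)
  moreover have "\<forall>\<^sub>F t in nhds t0. t \<in> T" by (rule eventually_nhds_in_open[OF T])
  ultimately show ?thesis
  proof eventually_elim
    case (elim t)
    then have t: "t \<in> J1" "c1 t \<in> fst ?\<phi>" "t \<in> J2" "c2 t \<in> fst ?\<phi>" unfolding T_def by auto
    have "c1 t = c2 t"
      using elim chart_inv_chart[OF \<phi>(1) t(2)] chart_inv_chart[OF \<phi>(1) t(4)]
      by (metis Pair_inject z1_def z2_def)
    moreover have "velocity A c1 t = tangent_of_coord A ?\<phi> (c1 t) (snd (z1 t))"
      using velocity_eq_tangent_of_coord[OF assms(1) c(1) \<phi>(1) t(1,2)] by (simp add: z1_def)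
    moreover have "velocity A c2 t = tangent_of_coord A ?\<phi> (c2 t) (snd (z2 t))"
      using velocity_eq_tangent_of_coord[OF assms(2) c(2) \<phi>(1) t(3,4)] by (simp add: z2_def)
    ultimately show ?case using elim by simp
  qed
qed

text \<open>If the points differ, they are separated by disjoint open sets. If they agree but the velocities
  differ, then the coordinate velocities in a common chart differ, and they do so nearby because they
  are continuous; distinct coordinate velocities at a common point are distinct velocities.\<close>

lemma smooth_curves_differ_openly:
  assumes "open J1" "open J2" "smooth_curve_on A c1 J1" "smooth_curve_on A c2 J2"
    and t0: "t0 \<in> J1" "t0 \<in> J2" "\<not> (c1 t0 = c2 t0 \<and> velocity A c1 t0 = velocity A c2 t0)"
  shows "\<forall>\<^sub>F t in nhds t0. \<not> (c1 t = c2 t \<and> velocity A c1 t = velocity A c2 t)"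
proof (cases "c1 t0 = c2 t0")
  case False
  then obtain U V where UV: "open U" "open V" "c1 t0 \<in> U" "c2 t0 \<in> V" "U \<inter> V = {}"
    using hausdorff[OF False] by auto
  have "open (J1 \<inter> c1 -` U)" "open (J2 \<inter> c2 -` V)"
    using continuous_open_preimage[OF _ assms(1) UV(1), of c1]
      continuous_open_preimage[OF _ assms(2) UV(2), of c2] assms(3,4)
    by (simp_all add: smooth_curve_on_def)
  then have "\<forall>\<^sub>F t in nhds t0. t \<in> J1 \<inter> c1 -` U" "\<forall>\<^sub>F t in nhds t0. t \<in> J2 \<inter> c2 -` V"
    using UV t0 by (blast intro: eventually_nhds_in_open)+
  then show ?thesis by eventually_elim (use UV(5) in auto)
next
  case True
  let ?\<phi> = "chart_at A (c1 t0)"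
  note \<phi> = chart_at[of "c1 t0"]
  define p where "p c t = vector_derivative (snd ?\<phi> \<circ> c) (at t)" for c t
  define T where "T = {t\<in>J1. c1 t \<in> fst ?\<phi>} \<inter> {t\<in>J2. c2 t \<in> fst ?\<phi>}"
  have T: "open T" "t0 \<in> T"
    unfolding T_def using curve_in_chart(1)[OF assms(1,3) \<phi>(1)]
      curve_in_chart(1)[OF assms(2,4) \<phi>(1)] t0 True \<phi>(2) by (auto intro: open_Int)
  have "continuous_on {t\<in>J1. c1 t \<in> fst ?\<phi>} (p c1)" "continuous_on {t\<in>J2. c2 t \<in> fst ?\<phi>} (p c2)"
    using smooth_curve_derivatives(3)[OF curve_in_chart[OF assms(1,3) \<phi>(1)], of t0]
      smooth_curve_derivatives(3)[OF curve_in_chart[OF assms(2,4) \<phi>(1)], of t0] T(2)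
    unfolding p_def[abs_def] T_def by auto
  then have "continuous_on T (p c1)" "continuous_on T (p c2)"
    unfolding T_def by (auto elim: continuous_on_subset)
  then have "continuous_on T (\<lambda>t. p c1 t - p c2 t)" by (rule continuous_on_diff)
  then have "open (T \<inter> (\<lambda>t. p c1 t - p c2 t) -` (- {0}))"
    using T(1) by (intro continuous_open_preimage) auto
  moreover have "t0 \<in> T \<inter> (\<lambda>t. p c1 t - p c2 t) -` (- {0})"
    using T(2) t0(3) True by (auto simp: velocity_def p_def)
  ultimately have "\<forall>\<^sub>F t in nhds t0. t \<in> T \<inter> (\<lambda>t. p c1 t - p c2 t) -` (- {0})"
    by (rule eventually_nhds_in_open)
  then show ?thesis
  proof eventually_elim
    case (elim t)
    then have t: "t \<in> J1" "c1 t \<in> fst ?\<phi>" "t \<in> J2" "c2 t \<in> fst ?\<phi>" "p c1 t \<noteq> p c2 t"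
      unfolding T_def by auto
    show ?case
      using velocity_eq_tangent_of_coord[OF assms(1,3) \<phi>(1) t(1,2)]
        velocity_eq_tangent_of_coord[OF assms(2,4) \<phi>(1) t(3,4)]
        tangent_of_coord_inj[OF \<phi>(1) t(2)] t(5)
      unfolding p_def by (metis injD)
  qed
qed

text \<open>Agreement to first order is locally constant in time: where it holds it persists nearby by
  uniqueness for the spray, and where it fails it keeps failing nearby. Connectedness of the
  interval does the rest.\<close>

lemma geodesic_uniqueness:
  assumes "open J1" "open J2" "geodesic_on A g c1 J1" "geodesic_on A g c2 J2"
    and I: "connected I" "I \<subseteq> J1 \<inter> J2" "t0 \<in> I" "t \<in> I"
    and init: "c1 t0 = c2 t0" "velocity A c1 t0 = velocity A c2 t0"
  shows "c1 t = c2 t"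
proof -
  let ?P = "\<lambda>t. c1 t = c2 t \<and> velocity A c1 t = velocity A c2 t"
  have "?P t"
  proof (rule connected_induction_simple[OF I(1), where P = ?P and a = t0])
    fix a assume a: "a \<in> I"
    have "\<forall>\<^sub>F t in nhds a. ?P t = ?P a"
    proof (cases "?P a")
      case True
      have "\<forall>\<^sub>F t in nhds a. ?P t"
        by (rule geodesic_local_uniqueness[OF assms(1-4)]) (use True a I in auto)
      then show ?thesis by eventually_elim (use True in simp)
    next
      case False
      have "\<forall>\<^sub>F t in nhds a. \<not> ?P t"
        by (rule smooth_curves_differ_openly[OF assms(1,2)])
          (use False a I assms(3,4) in \<open>auto simp: geodesic_on_def\<close>)
      then show ?thesis by eventually_elim (use False in blast)
    qed
    then obtain U where U: "open U" "a \<in> U" "\<forall>t\<in>U. ?P t = ?P a"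
      unfolding eventually_nhds by blast
    have "openin (top_of_set I) (I \<inter> U)" using U(1) by (rule openin_open_Int)
    moreover have "\<forall>x\<in>I \<inter> U. \<forall>y\<in>I \<inter> U. ?P x \<longrightarrow> ?P y" using U(3) by blast
    ultimately show "\<exists>T. openin (top_of_set I) T \<and> a \<in> T \<and> (\<forall>x\<in>T. \<forall>y\<in>T. ?P x \<longrightarrow> ?P y)"
      using U(2) a by blast
  qed (use I init in auto)
  then show ?thesis by blast
qed

text \<open>The exponential map is a definite description, so it has the expected value only because any two
  geodesics with the same initial data end at the same point.\<close>

lemma exp_map_eq:
  assumes "open J" "is_interval J" "{0..1} \<subseteq> J" "geodesic_on A g c J"
  shows "exp_map A g (c 0) (velocity A c 0) = c 1"
  unfolding exp_map_def
proof (rule the_equality)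
  show "\<exists>c' J. open J \<and> is_interval J \<and> {0..1} \<subseteq> J \<and> geodesic_on A g c' J \<and>
      c' 0 = c 0 \<and> velocity A c' 0 = velocity A c 0 \<and> c' 1 = c 1"
    using assms by blast
  fix q assume "\<exists>c' J. open J \<and> is_interval J \<and> {0..1} \<subseteq> J \<and> geodesic_on A g c' J \<and>
      c' 0 = c 0 \<and> velocity A c' 0 = velocity A c 0 \<and> c' 1 = q"
  then obtain c' J' where c': "open J'" "{0..1} \<subseteq> J'" "geodesic_on A g c' J'"
    "c' 0 = c 0" "velocity A c' 0 = velocity A c 0" "c' 1 = q" by blast
  have "c' 1 = c 1"
    by (rule geodesic_uniqueness[OF c'(1) assms(1) c'(3) assms(4), where I = "{0..1}" and ?t0.0 = 0])
      (use c' assms in auto)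
  then show "q = c 1" using c' by simp
qed

section \<open>Speed and arc length\<close>

definition speed :: "(real \<Rightarrow> 'a) \<Rightarrow> real \<Rightarrow> real" where
  "speed c t = sqrt (g (c t) (velocity A c t) (velocity A c t))"

lemma curve_length_eq_integral_speed: "curve_length A g c a b = integral {a..b} (speed c)"
  unfolding curve_length_def speed_def[abs_def] ..

lemma speed_affine_reparam:
  assumes "smooth_curve_on A c UNIV"
  shows "speed (\<lambda>s. c (a + s * b)) s = \<bar>b\<bar> * speed c (a + s * b)"
  unfolding speed_def
  by (simp add: velocity_affine_reparam[OF assms] bilinear_lmul[OF metric_bilinear]
      bilinear_rmul[OF metric_bilinear] real_sqrt_mult mult.assoc[symmetric])

text \<open>In a fixed chart, the squared speed is a finite sum of products of continuous functions, namely
  components of the coordinate velocity and coefficients of the metric.\<close>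

lemma continuous_on_speed:
  assumes "open J" "smooth_curve_on A c J"
  shows "continuous_on J (speed c)"
proof -
  have "isCont (speed c) t" if "t \<in> J" for t
  proof -
    let ?\<phi> = "chart_at A (c t)"
    note \<phi> = chart_at[of "c t"]
    let ?S = "{s\<in>J. c s \<in> fst ?\<phi>}" and ?p = "\<lambda>s. vector_derivative (snd ?\<phi> \<circ> c) (at s)"
    note S = curve_in_chart[OF assms \<phi>(1)]
    have t: "t \<in> ?S" using that \<phi> by blast
    have cont: "continuous_on ?S (snd ?\<phi> \<circ> c)" "continuous_on ?S ?p"
      using smooth_on_continuous[OF S(2)] smooth_curve_derivatives(3)[OF S t] by auto
    have m: "continuous_on ?S (\<lambda>s. metric_coord A g ?\<phi> ((snd ?\<phi> \<circ> c) s) b b')" for b b'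
      by (rule continuous_on_compose2[OF smooth_on_continuous[OF metric_coord_smooth[OF \<phi>(1)]] cont(1)]) auto
    have "continuous_on ?S (\<lambda>s. sqrt (\<Sum>b\<in>Basis. \<Sum>b'\<in>Basis. (?p s \<bullet> b) * (?p s \<bullet> b') *
        metric_coord A g ?\<phi> ((snd ?\<phi> \<circ> c) s) b b'))"
      by (intro continuous_intros cont m)
    then have "continuous_on ?S (speed c)"
    proof (rule continuous_on_eq)
      fix s assume s: "s \<in> ?S"
      then have im: "(snd ?\<phi> \<circ> c) s \<in> snd ?\<phi> ` fst ?\<phi>" by auto
      have "speed c s = sqrt (metric_coord A g ?\<phi> ((snd ?\<phi> \<circ> c) s) (?p s) (?p s))"
        using s velocity_eq_tangent_of_coord[OF assms \<phi>(1), of s] chart_inv_chart[OF \<phi>(1), of "c s"]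
        by (simp add: speed_def metric_coord_def)
      with bilinear_expand_Basis[OF metric_coord_bilinear[OF \<phi>(1) im], of "?p s" "?p s"]
      show "sqrt (\<Sum>b\<in>Basis. \<Sum>b'\<in>Basis. (?p s \<bullet> b) * (?p s \<bullet> b') *
        metric_coord A g ?\<phi> ((snd ?\<phi> \<circ> c) s) b b') = speed c s" by simp
    qed
    then show ?thesis using S(1) t continuous_on_eq_continuous_at by blast
  qed
  then show ?thesis by (simp add: continuous_at_imp_continuous_on)
qed

text \<open>The arc length is the integral of the speed, so its derivative is \<open>L\<close>. The curves \<open>c'\<close> and \<open>c\<close>
  may have different two-sided derivatives at \<open>0\<close> and \<open>1\<close>, which does not affect the integral; since
  \<open>c\<close> is smooth across these times, its speed is continuous and equals \<open>L\<close> at the end points too.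
  This is how the length of a piece controls the closed geodesic at the nodes.\<close>

lemma speed_of_proportional_parametrization:
  assumes "smooth_curve_on A c UNIV" "\<And>s. s \<in> {0..1} \<Longrightarrow> c' s = c s"
    and len: "\<And>t. t \<in> {0..1} \<Longrightarrow> curve_length A g c' 0 t = t * L"
    and t: "t \<in> {0..1}"
  shows "speed c t = L"
proof -
  have cont: "continuous_on {0..1} (speed c)"
    using continuous_on_speed[OF open_UNIV assms(1)] continuous_on_subset by blast
  have "integral {0..s} (speed c) = s * L" if s: "s \<in> {0..1}" for s
  proof -
    have "integral {0..s} (speed c) = integral {0..s} (speed c')"
    proof (rule integral_spike[of "{0, 1}"])
      fix r assume "r \<in> {0..s} - {0, 1}"
      then have r: "r \<in> {0<..<1}" using s by auto
      have "velocity A c' r = velocity A c r"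
        by (rule velocity_cong[of "{0<..<1}"]) (use r assms(2) in auto)
      then show "speed c' r = speed c r" using assms(2)[of r] r by (simp add: speed_def)
    qed simp
    then show ?thesis using len[OF s] by (simp add: curve_length_eq_integral_speed)
  qed
  moreover have "((\<lambda>s. integral {0..s} (speed c)) has_real_derivative speed c t) (at t within {0..1})"
    by (rule integral_has_real_derivative[OF cont t])
  ultimately have "((\<lambda>s. s * L) has_real_derivative speed c t) (at t within {0..1})"
    by (rule has_field_derivative_transform_within[of _ _ _ _ 1, rotated -1]) (use t in auto)
  moreover have "((\<lambda>s. s * L) has_real_derivative L) (at t within {0..1})"
    by (auto intro!: derivative_eq_intros)
  ultimately show ?thesis
    using vector_derivative_unique_within_closed_interval[of 0 1 t "\<lambda>s. s * L" "speed c t" L] t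
    by (simp add: has_real_derivative_iff_has_vector_derivative)
qed

section \<open>Logarithms along geodesics\<close>

text \<open>The injectivity radius is a supremum, which need not be attained. Two vectors of smaller norm lie in
  a common smaller ball on which the exponential map is a diffeomorphism.\<close>

lemma exp_map_inj_on: "inj_on (exp_map A g p) (tangent_ball g p (inj_radius A g p))"
proof (rule inj_onI)
  fix u v
  let ?n = "\<lambda>u. sqrt (g p u u)"
  assume u: "u \<in> tangent_ball g p (inj_radius A g p)" and v: "v \<in> tangent_ball g p (inj_radius A g p)"
    and eq: "exp_map A g p u = exp_map A g p v"
  have "ereal (max (?n u) (?n v)) < inj_radius A g p"
    using u v by (auto simp: tangent_ball_def max_def)
  then obtain \<rho> where \<rho>: "max (?n u) (?n v) < \<rho>"
    "diffeo_onto_image A (exp_map A g p) (tangent_ball g p (ereal \<rho>))"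
    unfolding inj_radius_def less_Sup_iff by auto
  then have "u \<in> tangent_ball g p (ereal \<rho>)" "v \<in> tangent_ball g p (ereal \<rho>)"
    by (auto simp: tangent_ball_def)
  then show "u = v" using \<rho>(2) eq unfolding diffeo_onto_image_def inj_on_def by blast
qed

text \<open>Negative \<open>b\<close> is allowed: it gives the logarithm of a point that the geodesic has passed before.\<close>

lemma log_map_along_geodesic:
  assumes "geodesic_on A g c UNIV" "ereal (\<bar>b\<bar> * speed c a) < inj_radius A g (c a)"
  shows "c (a + b) \<in> log_domain A g (c a)"
    and "log_map A g (c a) (c (a + b)) = b *\<^sub>R velocity A c a"
proof -
  let ?c = "\<lambda>s. c (a + s * b)"
  have c: "smooth_curve_on A c UNIV" using assms(1) unfolding geodesic_on_def by blast
  have v: "velocity A ?c 0 = b *\<^sub>R velocity A c a" using velocity_affine_reparam[OF c, of a b 0] by simp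
  have "exp_map A g (?c 0) (velocity A ?c 0) = ?c 1"
    by (rule exp_map_eq[of UNIV]) (use geodesic_affine_reparam[OF assms(1)] in auto)
  then have e: "exp_map A g (c a) (b *\<^sub>R velocity A c a) = c (a + b)" by (simp add: v)
  have "sqrt (g (c a) (b *\<^sub>R velocity A c a) (b *\<^sub>R velocity A c a)) = \<bar>b\<bar> * speed c a"
    using speed_affine_reparam[OF c, of a b 0] v by (simp add: speed_def)
  then have B: "b *\<^sub>R velocity A c a \<in> tangent_ball g (c a) (inj_radius A g (c a))"
    using assms(2) by (simp add: tangent_ball_def)
  show "c (a + b) \<in> log_domain A g (c a)"
    unfolding log_domain_def using B e by (metis image_eqI)
  show "log_map A g (c a) (c (a + b)) = b *\<^sub>R velocity A c a"
    unfolding log_map_def using inv_into_f_f[OF exp_map_inj_on B] e by simp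
qed

end

section \<open>Splay states\<close>

lemma prev_node_in: "i \<in> {1..N} \<Longrightarrow> prev_node N i \<in> {1..N}"
  by (auto simp: prev_node_def)

lemma next_prev_node: "i \<in> {1..N} \<Longrightarrow> next_node N (prev_node N i) = i"
  by (auto simp: next_node_def prev_node_def)

theorem proposition16:
  fixes A :: "('a::{t2_space, second_countable_topology}, 'e::euclidean_space) chart set"
    and g :: "'a \<Rightarrow> 'e \<Rightarrow> 'e \<Rightarrow> real"
    and N :: nat
    and w :: "nat \<Rightarrow> nat \<Rightarrow> real"
    and x :: "nat \<Rightarrow> 'a"
  assumes "complete_riemannian_manifold A g"
    and "0 < inf_inj_radius A g"
    and "3 \<le> N"
    and "cycle_weights N w"
    and "splay_state A g N w x"
  shows "consensus_equilibrium A g N w x"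
proof -
  interpret riemannian_manifold A g
    using assms(1) unfolding complete_riemannian_manifold_def by unfold_locales auto
  obtain cs \<tau> c \<epsilon> where cs: "\<forall>i\<in>{1..N}. is_unique_geodesic A g (x i) (x (next_node N i)) (cs i)"
    and concat: "is_concatenation N cs \<tau> c"
    and closed: "closed_geodesic A g c (\<tau> 0) (\<tau> N)"
    and \<epsilon>: "0 < \<epsilon>"
    and splay: "\<forall>i\<in>{1..N}. curve_length A g (cs i) 0 1 =
         inverse (w i (next_node N i)) / (\<Sum>j\<in>{1..N}. inverse (w j (next_node N j))) *
         curve_length A g c (\<tau> 0) (\<tau> N)"
    and short: "\<forall>i\<in>{1..N}. ereal (curve_length A g (cs i) 0 1) < inf_inj_radius A g - ereal \<epsilon>"
    using assms(5) unfolding splay_state_def by blast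
  have geo: "geodesic_on A g c UNIV" and per: "\<And>t. c (t + (\<tau> N - \<tau> 0)) = c t"
    using closed unfolding closed_geodesic_def by auto
  then have c: "smooth_curve_on A c UNIV" unfolding geodesic_on_def by blast
  define l where "l i = curve_length A g (cs i) 0 1" for i
  define d where "d i = \<tau> i - \<tau> (i - 1)" for i
  have d_pos: "0 < d i" and on_piece: "\<And>s. s \<in> {0..1} \<Longrightarrow> cs i s = c (\<tau> (i - 1) + s * d i)"
    if "i \<in> {1..N}" for i
    using concat that unfolding is_concatenation_def d_def by auto
  have ends: "c (\<tau> (i - 1)) = x i" "c (\<tau> i) = x (next_node N i)" if i: "i \<in> {1..N}" for i
  proof -
    have "cs i 0 = x i" "cs i 1 = x (next_node N i)"
      using cs i unfolding is_unique_geodesic_def geodesic_from_to_def by auto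
    then show "c (\<tau> (i - 1)) = x i" "c (\<tau> i) = x (next_node N i)"
      using on_piece[OF i, of 0] on_piece[OF i, of 1] by (auto simp: d_def)
  qed
  \<comment> \<open>\<open>l i\<close> is the constant speed of the \<open>i\<close>-th piece run over \<open>[0,1]\<close>; divided by \<open>d i\<close>, it is
    the speed of \<open>c\<close> on \<open>[\<tau> (i - 1), \<tau> i]\<close>, in particular at both nodes.\<close>
  have speeds: "d i * speed c (\<tau> (i - 1)) = l i" "d i * speed c (\<tau> i) = l i" if i: "i \<in> {1..N}" for i
  proof -
    have "speed (\<lambda>s. c (\<tau> (i - 1) + s * d i)) t = l i" if "t \<in> {0..1}" for t
    proof (rule speed_of_proportional_parametrization[OF smooth_curve_affine_reparam[OF c] _ _ that])
      show "cs i s = c (\<tau> (i - 1) + s * d i)" if "s \<in> {0..1}" for s using on_piece[OF i that] .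
      show "curve_length A g (cs i) 0 s = s * l i" if "s \<in> {0..1}" for s
        using cs i that unfolding is_unique_geodesic_def geodesic_from_to_def l_def by blast
    qed
    from this[of 0] this[of 1] show "d i * speed c (\<tau> (i - 1)) = l i" "d i * speed c (\<tau> i) = l i"
      using d_pos[OF i] by (auto simp: speed_affine_reparam[OF c] d_def)
  qed
  have weighted: "w i (next_node N i) * l i =
      curve_length A g c (\<tau> 0) (\<tau> N) / (\<Sum>j\<in>{1..N}. inverse (w j (next_node N j)))"
    if i: "i \<in> {1..N}" for i
  proof -
    have "0 < w i (next_node N i)" using assms(4) i unfolding cycle_weights_def by blast
    then show ?thesis using bspec[OF splay i] unfolding l_def by (simp add: divide_inverse)
  qed
  have inj: "ereal (l i) < inj_radius A g p" if "i \<in> {1..N}" for i p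
  proof -
    have "ereal (l i) < inf_inj_radius A g - ereal \<epsilon>" using short that unfolding l_def by blast
    also have "\<dots> \<le> inf_inj_radius A g" using \<epsilon> by (cases "inf_inj_radius A g") auto
    also have "\<dots> \<le> inj_radius A g p" unfolding inf_inj_radius_def by (rule INF_lower) simp
    finally show ?thesis .
  qed
  \<comment> \<open>Periodicity makes the end of the last piece fit the start of the first one to first order.\<close>
  have closing: "velocity A c (\<tau> N) = velocity A c (\<tau> 0)"
    using velocity_affine_reparam[OF c, of "\<tau> N - \<tau> 0" 1 "\<tau> 0"] per by (simp add: add.commute)
  show ?thesis
    unfolding consensus_equilibrium_def
  proof (intro ballI)
    fix i assume i: "i \<in> {1..N}"
    define j where "j = prev_node N i"
    have j: "j \<in> {1..N}" "next_node N j = i" unfolding j_def using prev_node_in next_prev_node i by auto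
    define V where "V = velocity A c (\<tau> (i - 1))"
    have Vj: "velocity A c (\<tau> j) = V"
      unfolding V_def j_def prev_node_def using closing by auto
    have cj: "c (\<tau> j) = x i" using ends(2)[OF j(1)] j(2) by simp
    have sj: "speed c (\<tau> j) = speed c (\<tau> (i - 1))"
      using Vj cj ends(1)[OF i] by (simp add: speed_def V_def)
    have "ereal (\<bar>d i\<bar> * speed c (\<tau> (i - 1))) < inj_radius A g (c (\<tau> (i - 1)))"
      using inj[OF i] speeds(1)[OF i] d_pos[OF i] by simp
    \<comment> \<open>The next node is reached from \<open>x i\<close> by following \<open>c\<close> forwards.\<close>
    from log_map_along_geodesic[OF geo this]
    have nxt: "x (next_node N i) \<in> log_domain A g (x i)"
      "log_map A g (x i) (x (next_node N i)) = d i *\<^sub>R V"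
      using ends[OF i] by (simp_all add: d_def V_def)
    have "ereal (\<bar>- d j\<bar> * speed c (\<tau> j)) < inj_radius A g (c (\<tau> j))"
      using inj[OF j(1)] speeds(2)[OF j(1)] d_pos[OF j(1)] by simp
    \<comment> \<open>The previous node is reached by following \<open>c\<close> backwards from time \<open>\<tau> j\<close>,
      which for \<open>i = 1\<close> is \<open>\<tau> N\<close> and not \<open>\<tau> 0\<close>.\<close>
    from log_map_along_geodesic[OF geo this]
    have prv: "x j \<in> log_domain A g (x i)" "log_map A g (x i) (x j) = - d j *\<^sub>R V"
      using ends(1)[OF j(1)] cj Vj by (simp_all add: d_def)
    \<comment> \<open>Both sides are the common value of weight times length on the two edges at \<open>i\<close>.\<close>
    have weight_length: "w i (next_node N i) * (d i * speed c (\<tau> (i - 1))) =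
        w j i * (d j * speed c (\<tau> (i - 1)))"
      using weighted[OF i] weighted[OF j(1)] speeds(1)[OF i] speeds(2)[OF j(1)] sj j(2) by simp
    have "(w i (next_node N i) * d i - w j i * d j) * speed c (\<tau> (i - 1)) = 0"
      using weight_length by (simp add: algebra_simps)
    \<comment> \<open>The speed vanishes only if \<open>c\<close> is at rest, and then both logarithms are zero.\<close>
    then consider "w i (next_node N i) * d i = w j i * d j" | "speed c (\<tau> (i - 1)) = 0" by auto
    then have "consensus_field A g N w x i = 0"
    proof cases
      case 1
      have "consensus_field A g N w x i = (w i (next_node N i) * d i - w j i * d j) *\<^sub>R V"
        unfolding consensus_field_def j_def[symmetric] nxt prv by (simp add: algebra_simps)
      then show ?thesis using 1 by simp
    next
      case 2
      then have "V = 0" using metric_pos[of V "x i"] ends(1)[OF i] unfolding speed_def V_def by fastforce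
      then show ?thesis unfolding consensus_field_def j_def[symmetric] nxt prv by simp
    qed
    then show "x (prev_node N i) \<in> log_domain A g (x i) \<and>
        x (next_node N i) \<in> log_domain A g (x i) \<and> consensus_field A g N w x i = 0"
      using nxt prv unfolding j_def by blast
  qed
qed

end
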